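(* Let $(\sigma,\pi)$ be a reduced weight pair. (I) All rational eigenvalues of $\mathsf{RSK}_{\sigma,\pi}$ are $\pm1$. (II) $\mathsf{RSK}_{\sigma,\pi}$ always has $1$ as an eigenvalue.
   Context: $\mathbb{N}=\{0,1,2,\dots\}$. RSK. A semistandard Young tableau is a filling of a Young diagram (English notation) by positive integers, weakly increasing along rows and strictly increasing down columns. Row insertion $P\leftarrow p$: if no label in the first row of $P$ exceeds $p$, append $p$ to the end of the first row; otherwise replace the leftmost occurrence of the smallest label $p'>p$ of the first row by $p$, and insert $p'$ in the same way into the tableau formed by the remaining rows. Inserting a biletter $(p|q)$ into a pair $(P,Q)$ of tableaux of the same shape yields $(P\leftarrow p,Q^\uparrow)$, where $Q^\uparrow$ is $Q$ with a new box labelled $q$ placed where $P\leftarrow p$ has a new box. For an $m\times n$ matrix $\alpha$ with entries in $\mathbb{N}$, list biletters by reading the entries of $\alpha$ down columns, columns from left to right, recording $\alpha_{i,j}$ copies of $(i|j)$. $\mathrm{RSK}(\alpha)=(P,Q)$ is the result of inserting these biletters successively into $(\emptyset,\emptyset)$. Operator. Let $R_{m,n}=\mathbb{C}[z_{ij}]_{1\le i\le m,1\le j\le n}$, $Z=[z_{ij}]$, and $z^\alpha=\prod_{i,j} z_{ij}^{\alpha_{i,j}}$. For semistandard $P,Q$ of the same shape, $[P|Q]\in R_{m,n}$ is the product over column positions $c$ of the minors of $Z$ whose row indices are the entries of the $c$-th column of $P$ and whose column indices are the entries of the $c$-th column of $Q$. Let $\mathsf{RSK}:R_{m,n}\to R_{m,n}$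 be the linear map with $z^\alpha\mapsto[P|Q]$ where $(P,Q)=\mathrm{RSK}(\alpha)$. Weight spaces. A weight pair of degree $d$ is $(\sigma,\pi)\in\mathbb{N}^m\times\mathbb{N}^n$ with $\sum_i\sigma_i=\sum_j\pi_j=d$; it is reduced if $\max_i\sigma_i+\max_j\pi_j\leq d$. $R_{\sigma,\pi}$ is the span of the monomials $z^\alpha$ such that $\alpha$ has row sums $\sigma$ and column sums $\pi$; it is preserved by $\mathsf{RSK}$, and $\mathsf{RSK}_{\sigma,\pi}$ is the restriction. *)

theory Defs
  imports "HOL-Library.Poly_Mapping" "Jordan_Normal_Form.Determinant"
begin

section \<open>The Robinson--Schensted--Knuth correspondence\<close>

text \<open>A tableau is the list of its rows, from top to bottom (English notation).\<close>

type_synonym tableau = "nat list list"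

text \<open>Row insertion \<open>P \<leftarrow> p\<close>. The length of the \<open>takeWhile\<close> prefix is the position of the
  leftmost occurrence of \<open>p'\<close> in the row.\<close>

fun row_insert :: "tableau \<Rightarrow> nat \<Rightarrow> tableau" where
  "row_insert [] p = [[p]]"
| "row_insert (r # rs) p =
     (if \<forall>x\<in>set r. x \<le> p then (r @ [p]) # rs
      else let p' = Min {x \<in> set r. p < x};
               k = length (takeWhile (\<lambda>x. x \<noteq> p') r)
           in r[k := p] # row_insert rs p')"

text \<open>If the shape of \<open>P'\<close> has exactly one box more than the shape of \<open>P\<close>, this is the (0-based)
  row of the additional box; it is \<open>length P\<close> if the box forms a new row.\<close>

definition new_box_row :: "tableau \<Rightarrow> tableau \<Rightarrow> nat" where
  "new_box_row P P' = length (takeWhile (\<lambda>(r, r'). length r = length r') (zip P P'))"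

definition add_box :: "tableau \<Rightarrow> nat \<Rightarrow> nat \<Rightarrow> tableau" where
  "add_box Q k q = (if k < length Q then Q[k := Q ! k @ [q]] else Q @ [[q]])"

fun insert_biletter :: "tableau \<times> tableau \<Rightarrow> nat \<times> nat \<Rightarrow> tableau \<times> tableau" where
  "insert_biletter (P, Q) (p, q) =
     (let P' = row_insert P p in (P', add_box Q (new_box_row P P') q))"

text \<open>Exponent matrices are finitely supported functions on pairs of indices; rows and columns are
  numbered from 1.\<close>

type_synonym expmat = "nat \<times> nat \<Rightarrow>\<^sub>0 nat"

definition exponent_matrices :: "nat \<Rightarrow> nat \<Rightarrow> expmat set" where
  "exponent_matrices m n = {\<alpha>. Poly_Mapping.keys \<alpha> \<subseteq> {1..m} \<times> {1..n}}"

definition biletters :: "nat \<Rightarrow> nat \<Rightarrow> expmat \<Rightarrow> (nat \<times> nat) list" where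
  "biletters m n \<alpha> =
     concat (map (\<lambda>j. concat (map (\<lambda>i. replicate (Poly_Mapping.lookup \<alpha> (i, j)) (i, j))
       [1..<Suc m])) [1..<Suc n])"

definition RSK :: "nat \<Rightarrow> nat \<Rightarrow> expmat \<Rightarrow> tableau \<times> tableau" where
  "RSK m n \<alpha> = foldl insert_biletter ([], []) (biletters m n \<alpha>)"


section \<open>The polynomial ring and the operator\<close>

text \<open>Polynomials over the complex numbers in the variables \<open>z\<^sub>i\<^sub>j\<close>, as finitely supported functions
  on exponents; multiplication is convolution.\<close>

type_synonym zpoly = "expmat \<Rightarrow>\<^sub>0 complex"

definition monomial :: "expmat \<Rightarrow> zpoly" where
  "monomial \<alpha> = Poly_Mapping.single \<alpha> 1"

definition zvar :: "nat \<Rightarrow> nat \<Rightarrow> zpoly" where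
  "zvar i j = monomial (Poly_Mapping.single (i, j) 1)"

definition scale :: "complex \<Rightarrow> zpoly \<Rightarrow> zpoly" where
  "scale c f = Poly_Mapping.map ((*) c) f"

lemma scale_conv_mult: "scale c f = Poly_Mapping.single 0 c * f"
  by (simp add: scale_def mult_map_scale_conv_mult)

lemma lookup_scale [simp]: "Poly_Mapping.lookup (scale c f) \<alpha> = c * Poly_Mapping.lookup f \<alpha>"
  by (simp add: scale_def Poly_Mapping.map.rep_eq when_def)

interpretation zpoly: vector_space scale
  by unfold_locales (auto intro!: poly_mapping_eqI simp: lookup_add algebra_simps)

definition column :: "tableau \<Rightarrow> nat \<Rightarrow> nat list" where
  "column T c = map (\<lambda>r. r ! c) (filter (\<lambda>r. c < length r) T)"

definition minor :: "nat list \<Rightarrow> nat list \<Rightarrow> zpoly" where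
  "minor is js = det (mat (length is) (length js) (\<lambda>(a, b). zvar (is ! a) (js ! b)))"

text \<open>The bitableau \<open>[P|Q]\<close>; the number of columns of a nonempty tableau is the length of its first
  row.\<close>

definition bitableau :: "tableau \<Rightarrow> tableau \<Rightarrow> zpoly" where
  "bitableau P Q =
     (\<Prod>c < (if P = [] then 0 else length (hd P)). minor (column P c) (column Q c))"

text \<open>The linear extension of \<open>z\<^sup>\<alpha> \<mapsto> [P|Q]\<close>. It is defined on all of \<^typ>\<open>zpoly\<close>, but only its
  values on the polynomials in the variables \<open>z\<^sub>i\<^sub>j\<close> with \<open>1 \<le> i \<le> m\<close> and \<open>1 \<le> j \<le> n\<close> are
  meaningful, since the indices outside this range are ignored by \<^const>\<open>biletters\<close>.\<close>

definition RSK_op :: "nat \<Rightarrow> nat \<Rightarrow> zpoly \<Rightarrow> zpoly" where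
  "RSK_op m n f =
     (\<Sum>\<alpha>\<in>Poly_Mapping.keys f.
       scale (Poly_Mapping.lookup f \<alpha>) (case RSK m n \<alpha> of (P, Q) \<Rightarrow> bitableau P Q))"

lemma RSK_op_monomial: "RSK_op m n (monomial \<alpha>) = (case RSK m n \<alpha> of (P, Q) \<Rightarrow> bitableau P Q)"
  by (simp add: RSK_op_def monomial_def)

lemma RSK_op_eq_sum:
  assumes "finite A" "Poly_Mapping.keys f \<subseteq> A"
  shows "RSK_op m n f =
     (\<Sum>\<alpha>\<in>A. scale (Poly_Mapping.lookup f \<alpha>) (case RSK m n \<alpha> of (P, Q) \<Rightarrow> bitableau P Q))"
  unfolding RSK_op_def
  using assms by (intro sum.mono_neutral_left) (auto simp: in_keys_iff)

lemma linear_RSK_op: "Vector_Spaces.linear scale scale (RSK_op m n)"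
proof unfold_locales
  fix f g :: zpoly and c :: complex
  have "Poly_Mapping.keys (f + g) \<subseteq> Poly_Mapping.keys f \<union> Poly_Mapping.keys g"
    by (rule Poly_Mapping.keys_add)
  then show "RSK_op m n (f + g) = RSK_op m n f + RSK_op m n g"
    by (simp add: RSK_op_eq_sum[of "Poly_Mapping.keys f \<union> Poly_Mapping.keys g"] lookup_add zpoly.scale_left_distrib
        sum.distrib)
  have "Poly_Mapping.keys (scale c f) \<subseteq> Poly_Mapping.keys f"
    by (auto simp: in_keys_iff)
  then show "RSK_op m n (scale c f) = scale c (RSK_op m n f)"
    by (simp add: RSK_op_eq_sum[of "Poly_Mapping.keys f"] zpoly.scale_sum_right)
qed


section \<open>Weight spaces\<close>

text \<open>Vectors in \<open>\<nat>\<^sup>m\<close> are functions of which only the values on \<open>{1..m}\<close> matter.\<close>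

definition weight_pair :: "nat \<Rightarrow> nat \<Rightarrow> nat \<Rightarrow> (nat \<Rightarrow> nat) \<Rightarrow> (nat \<Rightarrow> nat) \<Rightarrow> bool" where
  "weight_pair m n d \<sigma> \<pi> \<longleftrightarrow> (\<Sum>i=1..m. \<sigma> i) = d \<and> (\<Sum>j=1..n. \<pi> j) = d"

definition reduced_weight_pair :: "nat \<Rightarrow> nat \<Rightarrow> nat \<Rightarrow> (nat \<Rightarrow> nat) \<Rightarrow> (nat \<Rightarrow> nat) \<Rightarrow> bool" where
  "reduced_weight_pair m n d \<sigma> \<pi> \<longleftrightarrow>
     weight_pair m n d \<sigma> \<pi> \<and> Max (\<sigma> ` {1..m}) + Max (\<pi> ` {1..n}) \<le> d"

definition weight_space :: "nat \<Rightarrow> nat \<Rightarrow> (nat \<Rightarrow> nat) \<Rightarrow> (nat \<Rightarrow> nat) \<Rightarrow> zpoly set" where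
  "weight_space m n \<sigma> \<pi> = zpoly.span (monomial `
     {\<alpha> \<in> exponent_matrices m n.
        (\<forall>i\<in>{1..m}. (\<Sum>j=1..n. Poly_Mapping.lookup \<alpha> (i, j)) = \<sigma> i) \<and>
        (\<forall>j\<in>{1..n}. (\<Sum>i=1..m. Poly_Mapping.lookup \<alpha> (i, j)) = \<pi> j)})"

text \<open>\<open>c\<close> is an eigenvalue of the restriction of \<open>T\<close> to the \<open>T\<close>-invariant subspace \<open>V\<close>.\<close>

definition eigenvalue_on :: "zpoly set \<Rightarrow> (zpoly \<Rightarrow> zpoly) \<Rightarrow> complex \<Rightarrow> bool" where
  "eigenvalue_on V T c \<longleftrightarrow> (\<exists>f\<in>V. f \<noteq> 0 \<and> T f = scale c f)"

end

theory Submission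
  imports Defs "HOL-Library.Product_Lexorder" "Jordan_Normal_Form.Char_Poly"
begin

text \<open>
  Let \<open>M\<close> be the matrix of \<open>RSK\<close> on the monomials of the weight space; its entries are integers.
  Substitute \<open>Z = X Y\<close> for generic matrices \<open>X\<close> and \<open>Y\<close>. By the Cauchy--Binet expansion, the
  leading monomial (in a lexicographic order) of a bitableau \<open>[P|Q]\<close> becomes the product of
  \<open>x\<^sub>i\<^sub>k y\<^sub>k\<^sub>j\<close> over all boxes, where \<open>k\<close> is the row of the box and \<open>i\<close>, \<open>j\<close> are its labels in \<open>P\<close> and
  \<open>Q\<close>. It has coefficient 1, and it determines the multisets of labels of all rows, hence \<open>(P, Q)\<close>.
  As the RSK correspondence is injective, this yields an integer matrix \<open>C\<close> such that \<open>C M\<close> is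
  unitriangular for a suitable order of the monomials. So \<open>M\<close> has an integer inverse, and if \<open>c\<close> is a
  rational eigenvalue, then \<open>c\<close> and \<open>1/c\<close> are rational algebraic integers, that is \<open>c = \<plusminus>1\<close>.

  The eigenvalue 1 is attained at the monomial of the northwest corner matrix: its tableaux have a
  single row, so all minors in \<open>[P|Q]\<close> are of size 1.
\<close>

section \<open>Row insertion, one row at a time\<close>

text \<open>The reading order of \<open>biletters\<close>: column index first and row index second,
  as entries are read down columns.\<close>

definition biletter_le :: "nat \<times> nat \<Rightarrow> nat \<times> nat \<Rightarrow> bool" where
  "biletter_le a b \<longleftrightarrow> snd a < snd b \<or> snd a = snd b \<and> fst a \<le> fst b"

text \<open>In a sorted row this is the position of the bumped entry, or the length of the row if no
  entry exceeds \<open>p\<close>.\<close>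

definition bump_pos :: "nat list \<Rightarrow> nat \<Rightarrow> nat" where
  "bump_pos r p = length (takeWhile (\<lambda>x. x \<le> p) r)"

text \<open>A state consists of a row of \<open>P\<close>, the row of \<open>Q\<close> at the same height, and the biletters
  \<open>(p'|q)\<close> bumped out so far, which are the input of the rows below.\<close>

type_synonym row_state = "nat list \<times> nat list \<times> (nat \<times> nat) list"

fun row_step :: "row_state \<Rightarrow> nat \<times> nat \<Rightarrow> row_state" where
  "row_step (r, s, u) (p, q) =
     (if \<forall>x\<in>set r. x \<le> p then (r @ [p], s @ [q], u)
      else (r[bump_pos r p := p], s, u @ [(r ! bump_pos r p, q)]))"

definition row_pass :: "(nat \<times> nat) list \<Rightarrow> row_state" where
  "row_pass w = foldl row_step ([], [], []) w"

text \<open>The correspondence on words, so that it can be applied again to the bumped word that the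
  lower rows receive.\<close>

abbreviation RS :: "(nat \<times> nat) list \<Rightarrow> tableau \<times> tableau" where
  "RS w \<equiv> foldl insert_biletter ([], []) w"

lemma row_pass_Nil [simp]: "row_pass [] = ([], [], [])"
  by (simp add: row_pass_def)

lemma row_pass_snoc [simp]: "row_pass (w @ [b]) = row_step (row_pass w) b"
  by (simp add: row_pass_def)

lemma bump_pos_cases:
  assumes "sorted r" "\<not> (\<forall>x\<in>set r. x \<le> p)"
  shows "bump_pos r p < length r" "p < r ! bump_pos r p"
    "\<And>i. i < bump_pos r p \<Longrightarrow> r ! i \<le> p"
    "\<And>i. bump_pos r p \<le> i \<Longrightarrow> i < length r \<Longrightarrow> r ! bump_pos r p \<le> r ! i"
proof -
  let ?k = "bump_pos r p"
  show k: "?k < length r"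
    using assms(2) unfolding bump_pos_def
    by (metis length_takeWhile_le le_neq_implies_less takeWhile_eq_all_conv takeWhile_eq_take take_all_iff order_refl)
  show "p < r ! ?k"
    using nth_length_takeWhile[of "\<lambda>x. x \<le> p" r] k unfolding bump_pos_def by simp
  show "r ! i \<le> p" if "i < ?k" for i
    using that unfolding bump_pos_def by (metis nth_mem set_takeWhileD takeWhile_nth)
  show "r ! ?k \<le> r ! i" if "?k \<le> i" "i < length r" for i
    using assms(1) that by (simp add: sorted_nth_mono)
qed

lemma bump_pos_le_iff:
  assumes "sorted r" "i < length r"
  shows "bump_pos r p \<le> i \<longleftrightarrow> p < r ! i"
proof (cases "\<forall>x\<in>set r. x \<le> p")
  case True
  then have "bump_pos r p = length r"
    by (metis bump_pos_def takeWhile_eq_all_conv)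
  then show ?thesis using True assms by (auto simp: not_less dest: nth_mem)
next
  case False
  note b = bump_pos_cases[OF assms(1) False]
  show ?thesis using b(2) b(3)[of i] b(4)[of i] assms(2) by (meson leD le_less_trans not_le order.strict_trans1 order_less_le_trans)
qed

lemma bump_pos_eq_length: "\<forall>x\<in>set r. x \<le> p \<Longrightarrow> bump_pos r p = length r"
  by (metis bump_pos_def takeWhile_eq_all_conv)

text \<open>In a sorted row the first entry exceeding \<open>p\<close> is the smallest such entry,
  and everything before it is at most \<open>p\<close>, so it is also the leftmost occurrence of its
  value.\<close>

lemma row_insert_bump:
  assumes "sorted r" "\<not> (\<forall>x\<in>set r. x \<le> p)"
  shows "row_insert (r # rs) p = r[bump_pos r p := p] # row_insert rs (r ! bump_pos r p)"
proof -
  let ?k = "bump_pos r p"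
  note b = bump_pos_cases[OF assms]
  have min: "Min {x \<in> set r. p < x} = r ! ?k"
  proof (rule Min_eqI)
    show "r ! ?k \<le> y" if "y \<in> {x \<in> set r. p < x}" for y
      using that b(3,4) by (metis (mono_tags, lifting) in_set_conv_nth leD linorder_le_less_linear mem_Collect_eq)
  qed (use b in auto)
  have "length (takeWhile (\<lambda>x. x \<noteq> r ! ?k) r) = ?k"
  proof (subst takeWhile_eq_take_P_nth[where n = "?k"])
    show "\<And>i. i < ?k \<Longrightarrow> i < length r \<Longrightarrow> r ! i \<noteq> r ! ?k"
      using b(2,3) by (metis leD)
  qed (use b in auto)
  with min show ?thesis using assms(2) by (simp only: row_insert.simps if_False Let_def)
qed

lemma sorted_list_update_bump:
  assumes "sorted r" "\<not> (\<forall>x\<in>set r. x \<le> p)"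
  shows "sorted (r[bump_pos r p := p])"
  unfolding sorted_iff_nth_mono
proof (intro allI impI)
  fix i j
  assume "i \<le> j" "j < length (r[bump_pos r p := p])"
  then show "r[bump_pos r p := p] ! i \<le> r[bump_pos r p := p] ! j"
    using bump_pos_cases[OF assms] assms(1)
    by (auto simp: nth_list_update sorted_iff_nth_mono) (meson le_less_trans less_imp_le_nat order.trans)
qed

text \<open>The invariant relates the state to the last biletter processed. Its point is that among the
  biletters with a given label \<open>q\<close>, all that bump precede all that append a box.\<close>

fun row_inv :: "row_state \<Rightarrow> nat \<times> nat \<Rightarrow> bool" where
  "row_inv (r, s, u) (p, q) \<longleftrightarrow>
     (\<forall>y\<in>set s. y \<le> q) \<and> (q \<in> set s \<longrightarrow> (\<forall>x\<in>set r. x \<le> p)) \<and>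
     (\<forall>(x, y)\<in>set u. y < q \<or> y = q \<and> (\<forall>z\<in>set r. p < z \<longrightarrow> x \<le> z))"

fun row_ok :: "row_state \<Rightarrow> bool" where
  "row_ok (r, s, u) \<longleftrightarrow> sorted r \<and> sorted s \<and> sorted_wrt biletter_le u \<and> length r = length s"

text \<open>A label \<open>q2\<close> already in \<open>s\<close> would have to equal
  \<open>q\<close>. By the invariant no entry of the row would then exceed
  \<open>p \<le> p2\<close>, and \<open>p2\<close> would be appended instead of bumping.\<close>

lemma bumped_labels_less:
  assumes "row_inv (r, s, u) (p, q)" "biletter_le (p, q) (p2, q2)" "\<not> (\<forall>x\<in>set r. x \<le> p2)" "y \<in> set s"
  shows "y < q2"
proof (rule ccontr)
  assume "\<not> y < q2"
  then have "q2 = q" "q \<in> set s" using assms by (auto simp: biletter_le_def)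
  then have "\<forall>x\<in>set r. x \<le> p2" using assms by (auto simp: biletter_le_def)
  then show False using assms by simp
qed

lemma row_step_inv:
  assumes "row_ok st" "row_inv st b" "biletter_le b b2"
  shows "row_ok (row_step st b2) \<and> row_inv (row_step st b2) b2"
proof -
  obtain r s u where st: "st = (r, s, u)" by (cases st)
  obtain p q where b: "b = (p, q)" by (cases b)
  obtain p2 q2 where b2: "b2 = (p2, q2)" by (cases b2)
  note A = assms[unfolded st b b2]
  show ?thesis
  proof (cases "\<forall>x\<in>set r. x \<le> p2")
    case True
    have "q \<le> q2" using A by (auto simp: biletter_le_def)
    then show ?thesis using A True
      by (auto simp: st b2 sorted_append biletter_le_def)
  next
    case False
    note k = bump_pos_cases[OF _ False]
    let ?k = "bump_pos r p2"
    have srt: "sorted r" using A by simp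
    have less: "\<forall>y\<in>set s. y < q2"
      using bumped_labels_less[OF A(2,3) False] by blast
    have qq: "q \<le> q2" using A by (auto simp: biletter_le_def)
    \<comment> \<open>If \<open>u\<close> already holds a biletter \<open>(x, q2)\<close>, then
      \<open>x\<close> is at most every entry above \<open>p\<close>, in particular at most
      \<open>r ! ?k\<close>; so appending the new biletter keeps \<open>u\<close> sorted.\<close>
    have u1: "\<forall>(x, y)\<in>set u. y < q2 \<or> y = q2 \<and> q = q2 \<and> p \<le> p2 \<and> (\<forall>z\<in>set r. p < z \<longrightarrow> x \<le> z)"
      using A by (fastforce simp: biletter_le_def)
    have z0: "r ! ?k \<in> set r" "p2 < r ! ?k" using k srt by auto
    have z1: "r ! ?k \<le> z" if "z \<in> set r" "p2 < z" for z
      using that k(3,4)[OF srt] by (metis in_set_conv_nth leD linorder_le_less_linear)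
    have ub: "sorted_wrt biletter_le (u @ [(r ! ?k, q2)])"
      using A u1 z0 by (fastforce simp: sorted_wrt_append biletter_le_def)
    \<comment> \<open>Overwriting introduces only \<open>p2\<close>, so entries above
      \<open>p2\<close> are old ones and hence at least \<open>r ! ?k\<close>. This restores the
      invariant for the new biletter.\<close>
    have s2: "z \<in> set r" if "z \<in> set (r[?k := p2])" "p2 < z" for z
      using that set_update_subset_insert[of r ?k p2] by auto
    have "row_ok (row_step st b2)"
      using A ub sorted_list_update_bump[OF srt False]
      by (simp only: st b2 row_step.simps if_not_P[OF False] row_ok.simps length_list_update)
    moreover have "row_inv (row_step st b2) b2"
      unfolding st b2 row_step.simps if_not_P[OF False] row_inv.simps
      using less u1 s2 z1 by fastforce
    ultimately show ?thesis ..
  qed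
qed

lemma row_pass_inv:
  "sorted_wrt biletter_le w \<Longrightarrow> row_ok (row_pass w) \<and> (w \<noteq> [] \<longrightarrow> row_inv (row_pass w) (last w))"
proof (induction w rule: rev_induct)
  case Nil
  then show ?case by simp
next
  case (snoc b w)
  show ?case
  proof (cases "w = []")
    case True
    obtain p q where "b = (p, q)" by (cases b)
    then show ?thesis using True row_pass_snoc[of "[]" b] by simp
  next
    case False
    then have "biletter_le (last w) b" using snoc.prems by (simp add: sorted_wrt_append)
    then show ?thesis
      using snoc False row_step_inv[of "row_pass w" "last w" b] by (simp add: sorted_wrt_append)
  qed
qed

lemma row_pass_ok: "sorted_wrt biletter_le w \<Longrightarrow> row_pass w = (r, s, u) \<Longrightarrow>
    sorted r \<and> sorted s \<and> sorted_wrt biletter_le u \<and> length r = length s"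
  using row_pass_inv[of w] by simp

lemma row_pass_length: "row_pass w = (r, s, u) \<Longrightarrow> length w = length s + length u"
proof (induction w arbitrary: r s u rule: rev_induct)
  case (snoc b w)
  then show ?case by (cases "row_pass w"; cases b) (auto split: if_splits)
qed simp

lemma row_pass_nonempty: "w \<noteq> [] \<Longrightarrow> row_pass w = (r, s, u) \<Longrightarrow> r \<noteq> [] \<and> s \<noteq> []"
proof (induction w arbitrary: r s u rule: rev_induct)
  case (snoc b w)
  then show ?case using row_pass_snoc[of "[]" b]
    by (cases "row_pass w"; cases b; cases "w = []") (auto simp del: row_pass_snoc split: if_splits simp: row_pass_snoc[of w])
qed simp

lemma mset_bump:
  assumes "k < length r"
  shows "mset (r[k := p]) + {#r ! k#} = mset r + {#p#}"
  using assms by (simp add: mset_update) 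

lemma row_pass_mset:
  assumes "sorted_wrt biletter_le w" "row_pass w = (r, s, u)"
  shows "mset (map fst w) = mset r + mset (map fst u) \<and> mset (map snd w) = mset s + mset (map snd u)"
  using assms
proof (induction w arbitrary: r s u rule: rev_induct)
  case (snoc b w)
  obtain r0 s0 u0 where st: "row_pass w = (r0, s0, u0)" by (cases "row_pass w")
  obtain p q where b: "b = (p, q)" by (cases b)
  have w: "sorted_wrt biletter_le w" using snoc.prems by (simp add: sorted_wrt_append)
  show ?case
  proof (cases "\<forall>x\<in>set r0. x \<le> p")
    case True
    then show ?thesis using snoc.IH[OF w st] snoc.prems by (auto simp: st b)
  next
    case False
    have "sorted r0" using row_pass_ok[OF w st] by simp
    then have "bump_pos r0 p < length r0" using bump_pos_cases False by blast
    note m = mset_bump[OF this, of p]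
    have "r = r0[bump_pos r0 p := p]" "s = s0" "u = u0 @ [(r0 ! bump_pos r0 p, q)]"
      using snoc.prems(2) by (simp_all only: row_pass_snoc st b row_step.simps if_not_P[OF False] prod.inject)
    then show ?thesis using snoc.IH[OF w st] m by (simp add: b)
  qed
qed simp

text \<open>The lower rows see the first row only through the biletters bumped out of it. Peeling
  off the first row in this way allows induction over the rows of the tableaux.\<close>

lemma RS_row_pass:
  assumes "sorted_wrt biletter_le w" "w \<noteq> []" "row_pass w = (r, s, u)"
  shows "RS w = (r # fst (RS u), s # snd (RS u))"
  using assms
proof (induction w arbitrary: r s u rule: rev_induct)
  case (snoc b w)
  obtain r0 s0 u0 where st: "row_pass w = (r0, s0, u0)" by (cases "row_pass w")
  obtain p q where b: "b = (p, q)" by (cases b)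
  have w: "sorted_wrt biletter_le w" using snoc.prems by (simp add: sorted_wrt_append)
  show ?case
  proof (cases "w = []")
    case True
    then show ?thesis using snoc.prems b row_pass_snoc[of "[]" b]
      by (auto simp: Let_def new_box_row_def add_box_def)
  next
    case ne: False
    note IH = snoc.IH[OF w ne st]
    show ?thesis
    proof (cases "\<forall>x\<in>set r0. x \<le> p")
      case True
      then show ?thesis using IH snoc.prems
        by (auto simp: st b Let_def new_box_row_def add_box_def)
    next
      case False
      have "sorted r0" using row_pass_ok[OF w st] by simp
      note ins = row_insert_bump[OF this False]
      obtain P Q where PQ: "RS u0 = (P, Q)" by (cases "RS u0")
      \<comment> \<open>A bump leaves the length of the first row unchanged, so
        \<open>new_box_row\<close> passes over it and finds the new box in the rows below.\<close>
      have "insert_biletter (r0 # P, s0 # Q) (p, q) =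
        (r0[bump_pos r0 p := p] # fst (insert_biletter (P, Q) (r0 ! bump_pos r0 p, q)),
         s0 # snd (insert_biletter (P, Q) (r0 ! bump_pos r0 p, q)))"
        unfolding insert_biletter.simps ins
        by (simp add: Let_def new_box_row_def add_box_def)
      then show ?thesis using IH snoc.prems False PQ
        by (auto simp: st b if_not_P[OF False] simp del: insert_biletter.simps)
    qed
  qed
qed simp

section \<open>Injectivity and semistandardness\<close>

text \<open>Since bumps come first among equal labels, a tie between the last label of \<open>s\<close> and that of \<open>u\<close>
  means that the last step appended a box.\<close>

fun row_unstep :: "row_state \<Rightarrow> row_state \<times> (nat \<times> nat)" where
  "row_unstep (r, s, u) =
     (if s \<noteq> [] \<and> (u = [] \<or> snd (last u) \<le> last s)
      then ((butlast r, butlast s, u), (last r, last s))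
      else let (z, q) = last u; k = length (takeWhile (\<lambda>x. x < z) r) - 1
           in ((r[k := z], s, butlast u), (r ! k, q)))"

lemma row_unstep_step:
  assumes "row_ok (r, s, u)" "\<forall>y\<in>set s. y \<le> q" "\<forall>(x, y)\<in>set u. y \<le> q"
    "q \<in> set s \<longrightarrow> (\<forall>x\<in>set r. x \<le> p)"
  shows "row_unstep (row_step (r, s, u) (p, q)) = ((r, s, u), (p, q))"
proof (cases "\<forall>x\<in>set r. x \<le> p")
  case True
  have "u = [] \<or> snd (last u) \<le> q" using assms(3) last_in_set[of u] by (cases "last u") auto
  then show ?thesis using True by simp
next
  case False
  let ?k = "bump_pos r p" 
  let ?r = "r[?k := p]"
  have srt: "sorted r" using assms by simp
  note b = bump_pos_cases[OF this False]
  have "\<forall>y\<in>set s. y < q" using assms(2,4) False by (metis le_neq_implies_less)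
  then have lt: "s \<noteq> [] \<Longrightarrow> last s < q" by simp
  \<comment> \<open>Since \<open>p\<close> has replaced \<open>r ! ?k\<close>, the entries below the
    bumped value are exactly those up to and including position \<open>?k\<close>. This explains the
    \<open>- 1\<close> in \<open>row_unstep\<close>.\<close>
  have "length (takeWhile (\<lambda>x. x < r ! ?k) ?r) = Suc ?k"
  proof (subst takeWhile_eq_take_P_nth[where n = "Suc ?k"])
    show "\<And>i. i < Suc ?k \<Longrightarrow> i < length ?r \<Longrightarrow> ?r ! i < r ! ?k"
      using b(2) le_less_trans[OF b(3) b(2)] by (auto simp: nth_list_update less_Suc_eq)
    show "Suc ?k < length ?r \<Longrightarrow> \<not> ?r ! Suc ?k < r ! ?k"
      using b(4)[of "Suc ?k"] by simp
  qed (use b in auto)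
  then show ?thesis
    using lt b(1) unfolding row_step.simps if_not_P[OF False] by (auto simp: Let_def)
qed

lemma row_pass_unstep:
  assumes "sorted_wrt biletter_le (w @ [b])"
  shows "row_unstep (row_pass (w @ [b])) = (row_pass w, b)"
proof -
  obtain r s u where st: "row_pass w = (r, s, u)" by (cases "row_pass w")
  obtain p q where b: "b = (p, q)" by (cases b)
  have w: "sorted_wrt biletter_le w" using assms by (simp add: sorted_wrt_append)
  have ok: "row_ok (r, s, u)" using row_pass_inv[OF w] st by simp
  have "(\<forall>y\<in>set s. y \<le> q) \<and> (\<forall>(x, y)\<in>set u. y \<le> q) \<and> (q \<in> set s \<longrightarrow> (\<forall>x\<in>set r. x \<le> p))"
  proof (cases "w = []")
    case True
    then show ?thesis using st by simp
  next
    case False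
    obtain p0 q0 where l: "last w = (p0, q0)" by (cases "last w")
    have "biletter_le (p0, q0) (p, q)" using assms False by (metis b l last_in_set sorted_wrt_append list.set_intros(1))
    moreover have "row_inv (r, s, u) (p0, q0)" using row_pass_inv[OF w] st l False by simp
    ultimately show ?thesis by (fastforce simp: biletter_le_def)
  qed
  then show ?thesis using row_unstep_step[OF ok] unfolding row_pass_snoc st b by blast
qed

text \<open>Undoing the last step returns both the previous state and the last biletter, so the word
  is recovered from its end.\<close>

lemma row_pass_inj:
  assumes "sorted_wrt biletter_le w" "sorted_wrt biletter_le w'" "row_pass w = row_pass w'"
  shows "w = w'"
  using assms
proof (induction w arbitrary: w' rule: rev_induct)
  case Nil
  then show ?case by (cases "row_pass w'") (use row_pass_length[of w'] in auto)
next
  case (snoc b w)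
  obtain r s u where st: "row_pass w' = (r, s, u)" by (cases "row_pass w'")
  have "length w' = length (w @ [b])"
    using row_pass_length[OF st] row_pass_length[OF trans[OF snoc.prems(3) st]] by simp
  then obtain v c where w': "w' = v @ [c]" by (cases w' rule: rev_cases) auto
  have "(row_pass w, b) = (row_pass v, c)"
    using row_pass_unstep[OF snoc.prems(1)] row_pass_unstep[OF snoc.prems(2)[unfolded w']]
      snoc.prems(3)[unfolded w'] by (metis (no_types))
  moreover from this have "w = v"
    using snoc.IH[of v] snoc.prems(1,2) unfolding w' sorted_wrt_append by simp
  ultimately show ?case by (simp add: w')
qed

text \<open>Equal tableaux have equal first rows, and the bumped words have equal tableaux below
  them. The bumped words are shorter, hence equal by induction, and then \<open>row_pass_inj\<close>
  applies.\<close>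

lemma RS_inj:
  assumes "sorted_wrt biletter_le w" "sorted_wrt biletter_le w'" "RS w = RS w'"
  shows "w = w'"
  using assms
proof (induction "length w" arbitrary: w w' rule: less_induct)
  case less
  show ?case
  proof (cases "w = [] \<or> w' = []")
    case True
    \<comment> \<open>A nonempty word yields a nonempty tableau, so the two words are empty
      together.\<close>
    have "fst (RS v) \<noteq> []" if "sorted_wrt biletter_le v" "v \<noteq> []" for v
      using RS_row_pass[OF that] by (cases "row_pass v") auto
    then have "fst (RS v) = [] \<longleftrightarrow> v = []" if "sorted_wrt biletter_le v" for v
      using that by auto
    then show ?thesis using True less.prems by metis
  next
    case False
    obtain r s u where st: "row_pass w = (r, s, u)" by (cases "row_pass w")
    obtain r' s' u' where st': "row_pass w' = (r', s', u')" by (cases "row_pass w'")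
    have eq: "r = r'" "s = s'" "RS u = RS u'"
      using RS_row_pass[of w, OF _ _ st] RS_row_pass[of w', OF _ _ st'] less.prems False
      by (auto simp: prod_eq_iff)
    have "length u < length w"
      using row_pass_length[OF st] row_pass_nonempty[OF _ st] False by (cases s) auto
    moreover have "sorted_wrt biletter_le u" "sorted_wrt biletter_le u'"
      using row_pass_ok[OF _ st] row_pass_ok[OF _ st'] less.prems by auto
    ultimately have "u = u'" using less.hyps eq by blast
    then show ?thesis using row_pass_inj less.prems st st' eq by simp
  qed
qed

section \<open>Semistandardness of the tableaux\<close>

definition row_above :: "nat list \<Rightarrow> nat list \<Rightarrow> bool" where
  "row_above r r' \<longleftrightarrow> length r' \<le> length r \<and> (\<forall>c<length r'. r ! c < r' ! c)"

lemma row_above_trans: "row_above r r' \<Longrightarrow> row_above r' r'' \<Longrightarrow> row_above r r''"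
  unfolding row_above_def by (meson less_trans less_le_trans le_trans)

text \<open>As \<open>row_above\<close> is transitive, relating all pairs of rows amounts to
  relating adjacent ones. Excluding empty rows makes the list of rows unique for a given
  filling.\<close>

definition semistandard :: "tableau \<Rightarrow> bool" where
  "semistandard T \<longleftrightarrow> (\<forall>r\<in>set T. r \<noteq> [] \<and> sorted r) \<and> sorted_wrt row_above T"

text \<open>The first two rows are followed simultaneously. A letter bumped out of the first row
  enters the second row weakly to the left of its old column, where the entry now above it is
  smaller.\<close>

lemma row_pass_above:
  assumes "sorted_wrt biletter_le w" "row_pass w = (r, s, u)" "row_pass u = (r2, s2, u2)"
  shows "row_above r r2 \<and> row_above s s2"
  using assms
proof (induction w arbitrary: r s u r2 s2 u2 rule: rev_induct)
  case Nil
  then show ?case by (simp add: row_above_def)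
next
  case (snoc b w)
  obtain r0 s0 u0 where st: "row_pass w = (r0, s0, u0)" by (cases "row_pass w")
  obtain r1 s1 u1 where st1: "row_pass u0 = (r1, s1, u1)" by (cases "row_pass u0")
  obtain p q where b: "b = (p, q)" by (cases b)
  have w: "sorted_wrt biletter_le w" using snoc.prems by (simp add: sorted_wrt_append)
  have ok: "row_ok (r0, s0, u0)" using row_pass_inv[OF w] st by simp
  then have ok1: "row_ok (r1, s1, u1)" using row_pass_inv[of u0] st1 by simp
  note IH = snoc.IH[OF w st st1]
  show ?case
  proof (cases "\<forall>x\<in>set r0. x \<le> p")
    case True
    then have "r = r0 @ [p]" "s = s0 @ [q]" "u = u0" using snoc.prems by (auto simp: st b)
    then show ?thesis using IH st1 snoc.prems by (auto simp: row_above_def nth_append)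
  next
    case False
    let ?k = "bump_pos r0 p"
    have srt: "sorted r0" "sorted r1" using ok ok1 by simp_all
    note k = bump_pos_cases[OF srt(1) False]
    have r: "r = r0[?k := p]" "s = s0" "u = u0 @ [(r0 ! ?k, q)]"
      using snoc.prems(2) by (simp_all only: row_pass_snoc st b row_step.simps if_not_P[OF False] prod.inject)
    then have "w \<noteq> []" using False st by auto
    then have "biletter_le (last w) b" "row_inv (r0, s0, u0) (last w)"
      using snoc.prems(1) row_pass_inv[OF w] st by (auto simp: sorted_wrt_append)
    \<comment> \<open>Labels present in \<open>s0\<close> are strictly below the label of a bumping
      biletter; this gives strict columns in the recording tableau.\<close>
    then have sq: "\<forall>y\<in>set s0. y < q"
      using bumped_labels_less[of r0 s0 u0 "fst (last w)" "snd (last w)" p q] False b by auto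
    have step: "row_step (r1, s1, u1) (r0 ! ?k, q) = (r2, s2, u2)"
      using snoc.prems(3) r st1 by simp
    \<comment> \<open>If the second row has an entry in column \<open>?k\<close>, it exceeds
      \<open>r0 ! ?k\<close> by the induction hypothesis, so the bumped letter stops there or
      earlier.\<close>
    have k1: "bump_pos r1 (r0 ! ?k) \<le> ?k" 
    proof (cases "?k < length r1")
      case True
      then show ?thesis using IH by (simp add: bump_pos_le_iff srt row_above_def)
    next
      case False
      then show ?thesis by (metis bump_pos_def le_trans length_takeWhile_le not_le)
    qed
    have rle: "r ! c \<le> r0 ! c" if "c < length r0" for c
      using that k(2) by (cases "c = ?k") (auto simp: r)
    show ?thesis
    proof (cases "\<forall>x\<in>set r1. x \<le> r0 ! ?k")
      case True
      then have r2: "r2 = r1 @ [r0 ! ?k]" "s2 = s1 @ [q]" using step by auto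
      have len: "length r1 \<le> ?k" using k1 bump_pos_eq_length[OF True] by simp
      \<comment> \<open>Above the new box stands either the inserted \<open>p\<close> itself or an
        entry to its left, which is at most \<open>p\<close>.\<close>
      have "r ! length r1 < r0 ! ?k"
        using k(2) k(3)[of "length r1"] k(1) len
        by (cases "length r1 = ?k") (auto simp: r intro: le_less_trans)
      moreover have "r ! c < r1 ! c" if "c < length r1" for c
        using that IH rle[of c] by (auto simp: row_above_def intro: le_less_trans)
      ultimately have "row_above r r2"
        using len k(1) by (auto simp: row_above_def r2 r(1) nth_append less_Suc_eq)
      moreover have "row_above s s2"
        using IH len k(1) sq ok ok1 by (auto simp: row_above_def r2 r(2) nth_append less_Suc_eq)
      ultimately show ?thesis ..
    next
      case False
      let ?k1 = "bump_pos r1 (r0 ! ?k)"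
      have r2: "r2 = r1[?k1 := r0 ! ?k]" "s2 = s1"
        using step by (simp_all only: row_step.simps if_not_P[OF False] prod.inject)
      have "r ! ?k1 < r0 ! ?k"
        using k(2) k(3)[of ?k1] k(1) k1
        by (cases "?k1 = ?k") (auto simp: r intro: le_less_trans)
      moreover have rc: "r ! c < r1 ! c" if "c < length r1" for c
        using that IH rle[of c] by (auto simp: row_above_def intro: le_less_trans)
      ultimately have "row_above r r2"
        using IH k(1) unfolding row_above_def r2
        by (metis length_list_update nth_list_update_eq nth_list_update_neq r(1))
      then show ?thesis using IH r(2) r2(2) by simp
    qed
  qed
qed

lemma RS_semistandard:
  assumes "sorted_wrt biletter_le w" "RS w = (P, Q)"
  shows "semistandard P \<and> semistandard Q \<and> map length P = map length Q \<and>
    mset (concat P) = mset (map fst w) \<and> mset (concat Q) = mset (map snd w)"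
  using assms
proof (induction "length w" arbitrary: w P Q rule: less_induct)
  case less
  show ?case
  proof (cases "w = []")
    case True
    then show ?thesis using less.prems by (simp add: semistandard_def)
  next
    case False
    obtain r s u where st: "row_pass w = (r, s, u)" by (cases "row_pass w")
    obtain P' Q' where PQ': "RS u = (P', Q')" by (cases "RS u")
    have PQ: "P = r # P'" "Q = s # Q'"
      using RS_row_pass[OF less.prems(1) False st] less.prems(2) PQ' by auto
    have ne: "r \<noteq> []" "s \<noteq> []" using row_pass_nonempty[OF False st] by auto
    then have "length u < length w" using row_pass_length[OF st] by (cases s) auto
    moreover have ok: "sorted_wrt biletter_le u" "sorted r" "sorted s" "length r = length s"
      using row_pass_ok[OF less.prems(1) st] by auto
    ultimately have IH: "semistandard P' \<and> semistandard Q' \<and> map length P' = map length Q' \<and>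
        mset (concat P') = mset (map fst u) \<and> mset (concat Q') = mset (map snd u)"
      using less.hyps PQ' by blast
    have ab: "(\<forall>r'\<in>set P'. row_above r r') \<and> (\<forall>s'\<in>set Q'. row_above s s')"
    proof (cases "u = []")
      case True
      then show ?thesis using PQ' by simp
    next
      case u: False
      obtain r2 s2 u2 where st2: "row_pass u = (r2, s2, u2)" by (cases "row_pass u")
      have "row_above r r2" "row_above s s2" using row_pass_above[OF less.prems(1) st st2] by auto
      moreover have "P' = r2 # fst (RS u2)" "Q' = s2 # snd (RS u2)"
        using RS_row_pass[OF ok(1) u st2] PQ' by auto
      ultimately show ?thesis using IH row_above_trans unfolding semistandard_def
        by (metis set_ConsD sorted_wrt.simps(2))
    qed
    show ?thesis
      using IH ab ok ne row_pass_mset[OF less.prems(1) st] by (simp add: PQ semistandard_def)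
  qed
qed

section \<open>Exponent matrices and words of biletters\<close>

text \<open>Multisets make exponents, words of biletters, margins and labels of tableaux directly
  comparable.\<close>

definition exp_mset :: "('a \<Rightarrow>\<^sub>0 nat) \<Rightarrow> 'a multiset" where
  "exp_mset \<alpha> = (\<Sum>k\<in>Poly_Mapping.keys \<alpha>. replicate_mset (Poly_Mapping.lookup \<alpha> k) k)"

lemma exp_mset_superset:
  assumes "finite A" "Poly_Mapping.keys \<alpha> \<subseteq> A"
  shows "exp_mset \<alpha> = (\<Sum>k\<in>A. replicate_mset (Poly_Mapping.lookup \<alpha> k) k)"
  unfolding exp_mset_def using assms by (intro sum.mono_neutral_left) (auto simp: in_keys_iff)

lemma count_exp_mset [simp]: "count (exp_mset \<alpha>) k = Poly_Mapping.lookup \<alpha> k"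
  by (simp add: exp_mset_def count_sum in_keys_iff)

lemma exp_mset_inject [simp]: "exp_mset \<alpha> = exp_mset \<beta> \<longleftrightarrow> \<alpha> = \<beta>"
  by (metis count_exp_mset poly_mapping_eqI)

lemma exp_mset_add [simp]: "exp_mset (\<alpha> + \<beta>) = exp_mset \<alpha> + exp_mset \<beta>"
  by (rule multiset_eqI) (simp add: lookup_add)

lemma exp_mset_0 [simp]: "exp_mset 0 = {#}"
  by (rule multiset_eqI) simp

lemma exp_mset_sum: "exp_mset (sum f A) = (\<Sum>x\<in>A. exp_mset (f x))"
  by (induction A rule: infinite_finite_induct) auto

lemma exp_mset_single [simp]: "exp_mset (Poly_Mapping.single k (Suc 0)) = {#k#}"
  by (rule multiset_eqI) (simp add: lookup_single when_def)

lemma set_exp_mset: "set_mset (exp_mset \<alpha>) = Poly_Mapping.keys \<alpha>"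
  by (auto simp: set_mset_def in_keys_iff)

lemma mset_biletters:
  assumes "\<alpha> \<in> exponent_matrices m n"
  shows "mset (biletters m n \<alpha>) = exp_mset \<alpha>"
proof -
  have "mset (biletters m n \<alpha>) =
      (\<Sum>j\<in>{1..n}. \<Sum>i\<in>{1..m}. replicate_mset (Poly_Mapping.lookup \<alpha> (i, j)) (i, j))"
    by (simp add: biletters_def mset_concat comp_def interv_sum_list_conv_sum_set_nat
        atLeastLessThanSuc_atLeastAtMost del: upt_Suc)
  also have "\<dots> = (\<Sum>k\<in>{1..m} \<times> {1..n}. replicate_mset (Poly_Mapping.lookup \<alpha> k) k)"
    by (subst sum.swap) (simp add: sum.cartesian_product case_prod_unfold)
  also have "\<dots> = exp_mset \<alpha>"
    using assms by (intro exp_mset_superset[symmetric]) (auto simp: exponent_matrices_def)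
  finally show ?thesis .
qed

lemma sorted_wrt_concat_map:
  assumes "sorted_wrt R xs" "\<And>x. x \<in> set xs \<Longrightarrow> sorted_wrt S (f x)"
    "\<And>x y a b. x \<in> set xs \<Longrightarrow> y \<in> set xs \<Longrightarrow> R x y \<Longrightarrow> a \<in> set (f x) \<Longrightarrow> b \<in> set (f y) \<Longrightarrow> S a b"
  shows "sorted_wrt S (concat (map f xs))"
  using assms by (induction xs) (fastforce simp: sorted_wrt_append)+

lemma sorted_biletters: "sorted_wrt biletter_le (biletters m n \<alpha>)"
  unfolding biletters_def
proof (rule sorted_wrt_concat_map[where R = "(<)"])
  fix j
  show "sorted_wrt biletter_le (concat (map (\<lambda>i. replicate (Poly_Mapping.lookup \<alpha> (i, j)) (i, j)) [1..<Suc m]))"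
  proof (rule sorted_wrt_concat_map[where R = "(<)"])
    show "sorted_wrt biletter_le (replicate (Poly_Mapping.lookup \<alpha> (i, j)) (i, j))" for i
      unfolding sorted_wrt_iff_nth_less by (auto simp: biletter_le_def)
  qed (auto simp: biletter_le_def simp del: upt_Suc)
qed (auto simp: biletter_le_def simp del: upt_Suc)

text \<open>After swapping components the reading order is the lexicographic order on pairs, for
  which a sorted list is determined by its multiset.\<close>

lemma sorted_biletters_unique:
  assumes "sorted_wrt biletter_le v" "sorted_wrt biletter_le w" "mset v = mset w"
  shows "v = w"
proof -
  have s: "sorted (map prod.swap w)" if "sorted_wrt biletter_le w" for w
    unfolding sorted_wrt_map by (rule sorted_wrt_mono_rel[OF _ that]) (auto simp: biletter_le_def less_eq_prod_def)
  have "map prod.swap v = map prod.swap w"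
    using assms s by (metis mset_map properties_for_sort)
  then show ?thesis by (simp add: inj_map_eq_map)
qed

section \<open>Weights and their exponent matrices\<close>

definition weight_mset :: "nat \<Rightarrow> (nat \<Rightarrow> nat) \<Rightarrow> nat multiset" where
  "weight_mset m \<sigma> = (\<Sum>i=1..m. replicate_mset (\<sigma> i) i)"

lemma count_weight_mset: "count (weight_mset m \<sigma>) i = (if i \<in> {1..m} then \<sigma> i else 0)"
  by (simp add: weight_mset_def count_sum)

lemma size_weight_mset: "size (weight_mset m \<sigma>) = (\<Sum>i=1..m. \<sigma> i)"
  by (simp add: weight_mset_def size_multiset_sum)

lemma set_weight_mset: "set_mset (weight_mset m \<sigma>) \<subseteq> {1..m}"
  by (auto simp: set_mset_def count_weight_mset split: if_splits)

lemma weight_mset_eq_iff: "weight_mset m \<sigma> = weight_mset m \<tau> \<longleftrightarrow> (\<forall>i\<in>{1..m}. \<sigma> i = \<tau> i)"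
  by (auto simp: multiset_eq_iff count_weight_mset)

text \<open>The margins as multisets of row and column indices; these equations also confine the
  support to \<open>{1..m} \<times> {1..n}\<close>.\<close>

definition weight_exps :: "nat \<Rightarrow> nat \<Rightarrow> (nat \<Rightarrow> nat) \<Rightarrow> (nat \<Rightarrow> nat) \<Rightarrow> expmat set" where
  "weight_exps m n \<sigma> \<pi> = {\<alpha>. image_mset fst (exp_mset \<alpha>) = weight_mset m \<sigma> \<and>
     image_mset snd (exp_mset \<alpha>) = weight_mset n \<pi>}"

lemma replicate_mset_sum: "replicate_mset (sum f A) x = (\<Sum>a\<in>A. replicate_mset (f a) x)"
  by (rule multiset_eqI) (simp add: count_sum)

lemma image_mset_sum: "image_mset f (sum g A) = (\<Sum>a\<in>A. image_mset f (g a))"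
  by (induction A rule: infinite_finite_induct) auto

lemma weight_exps_exponent_matrices:
  assumes "\<alpha> \<in> weight_exps m n \<sigma> \<pi>"
  shows "\<alpha> \<in> exponent_matrices m n"
proof -
  have "fst ` Poly_Mapping.keys \<alpha> \<subseteq> {1..m}" "snd ` Poly_Mapping.keys \<alpha> \<subseteq> {1..n}"
    using assms set_weight_mset unfolding weight_exps_def
    by (metis (mono_tags, lifting) mem_Collect_eq set_exp_mset set_image_mset)+
  then show ?thesis by (force simp: exponent_matrices_def)
qed

lemma weight_exps_eq:
  "weight_exps m n \<sigma> \<pi> = {\<alpha> \<in> exponent_matrices m n.
        (\<forall>i\<in>{1..m}. (\<Sum>j=1..n. Poly_Mapping.lookup \<alpha> (i, j)) = \<sigma> i) \<and>
        (\<forall>j\<in>{1..n}. (\<Sum>i=1..m. Poly_Mapping.lookup \<alpha> (i, j)) = \<pi> j)}"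
proof -
  have H: "image_mset fst (exp_mset \<alpha>) = weight_mset m (\<lambda>i. \<Sum>j=1..n. Poly_Mapping.lookup \<alpha> (i, j)) \<and>
      image_mset snd (exp_mset \<alpha>) = weight_mset n (\<lambda>j. \<Sum>i=1..m. Poly_Mapping.lookup \<alpha> (i, j))"
    if "\<alpha> \<in> exponent_matrices m n" for \<alpha> :: expmat
  proof -
    have e: "exp_mset \<alpha> = (\<Sum>i=1..m. \<Sum>j=1..n. replicate_mset (Poly_Mapping.lookup \<alpha> (i, j)) (i, j))"
      using that exp_mset_superset[of "{1..m} \<times> {1..n}" \<alpha>]
      by (simp add: exponent_matrices_def sum.cartesian_product case_prod_unfold)
    show ?thesis
      unfolding weight_mset_def replicate_mset_sum
      using sum.swap[of "\<lambda>i j. replicate_mset (Poly_Mapping.lookup \<alpha> (i, j)) j" "{1..n}" "{1..m}"]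
      unfolding e by (simp only: image_mset_sum image_replicate_mset fst_conv snd_conv)
  qed
  have "\<alpha> \<in> weight_exps m n \<sigma> \<pi> \<longleftrightarrow> \<alpha> \<in> exponent_matrices m n \<and>
        (\<forall>i\<in>{1..m}. (\<Sum>j=1..n. Poly_Mapping.lookup \<alpha> (i, j)) = \<sigma> i) \<and>
        (\<forall>j\<in>{1..n}. (\<Sum>i=1..m. Poly_Mapping.lookup \<alpha> (i, j)) = \<pi> j)" for \<alpha>
  proof (cases "\<alpha> \<in> exponent_matrices m n")
    case True
    then show ?thesis
      by (simp only: weight_exps_def mem_Collect_eq H[OF True] weight_mset_eq_iff simp_thms)
  next
    case False
    then show ?thesis using weight_exps_exponent_matrices by blast
  qed
  then show ?thesis by blast
qed

lemma inj_on_biletters: "inj_on (biletters m n) (exponent_matrices m n)"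
  by (rule inj_onI) (metis exp_mset_inject mset_biletters)

text \<open>An exponent is determined by its word of biletters, and these words have a fixed length
  over a finite alphabet.\<close>

lemma finite_weight_exps: "finite (weight_exps m n \<sigma> \<pi>)"
proof (rule finite_imageD)
  let ?L = "{w. set w \<subseteq> {1..m} \<times> {1..n} \<and> length w = (\<Sum>i=1..m. \<sigma> i)}"
  have "biletters m n \<alpha> \<in> ?L" if "\<alpha> \<in> weight_exps m n \<sigma> \<pi>" for \<alpha>
  proof -
    have e: "\<alpha> \<in> exponent_matrices m n" using that by (rule weight_exps_exponent_matrices)
    have "set (biletters m n \<alpha>) = Poly_Mapping.keys \<alpha>"
      by (metis e mset_biletters set_exp_mset set_mset_mset)
    moreover have "length (biletters m n \<alpha>) = size (image_mset fst (exp_mset \<alpha>))"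
      by (metis e mset_biletters size_image_mset size_mset)
    ultimately show ?thesis using that e
      by (simp add: weight_exps_def exponent_matrices_def size_weight_mset del: size_image_mset)
  qed
  then show "finite (biletters m n ` weight_exps m n \<sigma> \<pi>)"
    by (intro finite_subset[OF _ finite_lists_length_eq[of "{1..m} \<times> {1..n}" "\<Sum>i=1..m. \<sigma> i"]]) auto
  show "inj_on (biletters m n) (weight_exps m n \<sigma> \<pi>)"
    by (rule inj_on_subset[OF inj_on_biletters]) (auto intro: weight_exps_exponent_matrices)
qed

lemma RSK_eq_RS: "RSK m n \<alpha> = RS (biletters m n \<alpha>)"
  by (simp add: RSK_def)

lemma inj_on_RSK: "inj_on (RSK m n) (exponent_matrices m n)"
  by (rule inj_onI) (metis RSK_eq_RS RS_inj inj_on_biletters inj_onD sorted_biletters)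

lemma RSK_semistandard:
  assumes "\<alpha> \<in> weight_exps m n \<sigma> \<pi>" "RSK m n \<alpha> = (P, Q)"
  shows "semistandard P" "semistandard Q" "map length P = map length Q"
    "mset (concat P) = weight_mset m \<sigma>" "mset (concat Q) = weight_mset n \<pi>"
  using RS_semistandard[OF sorted_biletters[of m n \<alpha>], of P Q] assms
    mset_biletters[OF weight_exps_exponent_matrices[OF assms(1)]]
  by (auto simp: RSK_eq_RS weight_exps_def)

section \<open>Substitutions and leading monomials\<close>

definition poly_subst :: "('v \<Rightarrow> 'b::comm_monoid_add \<Rightarrow>\<^sub>0 complex) \<Rightarrow> (('v \<Rightarrow>\<^sub>0 nat) \<Rightarrow>\<^sub>0 complex) \<Rightarrow> 'b \<Rightarrow>\<^sub>0 complex" where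
  "poly_subst h f = (\<Sum>\<alpha>\<in>Poly_Mapping.keys f.
     Poly_Mapping.single 0 (Poly_Mapping.lookup f \<alpha>) * (\<Prod>v\<in>#exp_mset \<alpha>. h v))"

lemma poly_subst_superset:
  assumes "finite A" "Poly_Mapping.keys f \<subseteq> A"
  shows "poly_subst h f = (\<Sum>\<alpha>\<in>A.
     Poly_Mapping.single 0 (Poly_Mapping.lookup f \<alpha>) * (\<Prod>v\<in>#exp_mset \<alpha>. h v))"
  unfolding poly_subst_def using assms by (intro sum.mono_neutral_left) (auto simp: in_keys_iff)

lemma poly_subst_single:
  "poly_subst h (Poly_Mapping.single \<alpha> c) = Poly_Mapping.single 0 c * (\<Prod>v\<in>#exp_mset \<alpha>. h v)"
  by (subst poly_subst_superset[of "{\<alpha>}"]) auto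

lemma poly_subst_0 [simp]: "poly_subst h 0 = 0"
  by (simp add: poly_subst_def)

lemma poly_subst_add: "poly_subst h (f + g) = poly_subst h f + poly_subst h g"
proof -
  let ?A = "Poly_Mapping.keys f \<union> Poly_Mapping.keys g"
  have "Poly_Mapping.keys (f + g) \<subseteq> ?A" by (rule Poly_Mapping.keys_add)
  then show ?thesis
    by (simp add: poly_subst_superset[of ?A] lookup_add single_add algebra_simps sum.distrib)
qed

lemma poly_subst_sum: "poly_subst h (sum f A) = (\<Sum>x\<in>A. poly_subst h (f x))"
  by (induction A rule: infinite_finite_induct) (auto simp: poly_subst_add)

lemma poly_mapping_eq_sum_single:
  "f = (\<Sum>k\<in>Poly_Mapping.keys f. Poly_Mapping.single k (Poly_Mapping.lookup f k))"
  by (rule poly_mapping_eqI) (simp add: lookup_sum lookup_single when_def in_keys_iff)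

text \<open>By bilinearity it suffices to multiply single terms, whose exponents add.\<close>

lemma poly_subst_mult:
  fixes h :: "'v \<Rightarrow> 'b::comm_monoid_add \<Rightarrow>\<^sub>0 complex"
  shows "poly_subst h (f * g) = poly_subst h f * poly_subst h g"
proof -
  have s: "poly_subst h (Poly_Mapping.single \<alpha> c * Poly_Mapping.single \<beta> d) =
      poly_subst h (Poly_Mapping.single \<alpha> c) * poly_subst h (Poly_Mapping.single \<beta> d)" for \<alpha> \<beta> c d
  proof -
    have "(Poly_Mapping.single 0 (c * d) :: 'b \<Rightarrow>\<^sub>0 complex) = Poly_Mapping.single 0 c * Poly_Mapping.single 0 d"
      by (simp add: mult_single)
    then show ?thesis by (simp add: mult_single[of \<alpha> c] poly_subst_single mult_ac)
  qed
  have "poly_subst h ((\<Sum>k\<in>Poly_Mapping.keys f. Poly_Mapping.single k (Poly_Mapping.lookup f k)) *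
        (\<Sum>k\<in>Poly_Mapping.keys g. Poly_Mapping.single k (Poly_Mapping.lookup g k))) =
      poly_subst h (\<Sum>k\<in>Poly_Mapping.keys f. Poly_Mapping.single k (Poly_Mapping.lookup f k)) *
      poly_subst h (\<Sum>k\<in>Poly_Mapping.keys g. Poly_Mapping.single k (Poly_Mapping.lookup g k))"
    by (simp only: sum_product poly_subst_sum s)
  then show ?thesis by (simp only: poly_mapping_eq_sum_single[symmetric])
qed

lemma comm_ring_hom_poly_subst: "comm_ring_hom (poly_subst h)"
proof
  show "poly_subst h 1 = 1"
    using poly_subst_single[of h 0 1] by simp
qed (simp_all add: poly_subst_add poly_subst_mult)

text \<open>Leading coefficient 1 is built in: it becomes the diagonal of the triangular matrix
  \<open>C * M\<close>.\<close>

definition has_lead :: "('b::{linorder, ordered_cancel_comm_monoid_add} \<Rightarrow>\<^sub>0 complex) \<Rightarrow> 'b \<Rightarrow> bool" where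
  "has_lead f \<mu> \<longleftrightarrow> Poly_Mapping.lookup f \<mu> = 1 \<and> (\<forall>\<nu>\<in>Poly_Mapping.keys f. \<nu> \<le> \<mu>)"

lemma has_lead_1: "has_lead 1 0"
  by (simp add: has_lead_def)

text \<open>Split off both leading terms. Every other product of terms has an exponent strictly
  below \<open>\<mu> + \<nu>\<close>, by strict monotonicity of addition.\<close>

lemma has_lead_mult:
  assumes "has_lead f \<mu>" "has_lead g \<nu>"
  shows "has_lead (f * g) (\<mu> + \<nu>)"
proof -
  define f' g' where "f' = f - Poly_Mapping.single \<mu> 1" and "g' = g - Poly_Mapping.single \<nu> 1"
  have f: "f = Poly_Mapping.single \<mu> 1 + f'" and g: "g = Poly_Mapping.single \<nu> 1 + g'"
    by (simp_all add: f'_def g'_def)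
  have kf: "k < \<mu>" if "k \<in> Poly_Mapping.keys f'" for k
    using that assms(1) unfolding f'_def has_lead_def
    by (auto simp: in_keys_iff lookup_minus lookup_single when_def order_less_le split: if_splits)
  have kg: "k < \<nu>" if "k \<in> Poly_Mapping.keys g'" for k
    using that assms(2) unfolding g'_def has_lead_def
    by (auto simp: in_keys_iff lookup_minus lookup_single when_def order_less_le split: if_splits)
  let ?r = "Poly_Mapping.single \<mu> 1 * g' + f' * Poly_Mapping.single \<nu> 1 + f' * g'"
  have fg: "f * g = Poly_Mapping.single (\<mu> + \<nu>) 1 + ?r"
    by (subst f, subst g) (simp add: distrib_left distrib_right mult_single add_ac)
  have less: "k < \<mu> + \<nu>" if k: "k \<in> Poly_Mapping.keys ?r" for k
  proof -
    have "k \<in> Poly_Mapping.keys (Poly_Mapping.single \<mu> (1::complex) * g') \<or>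
        k \<in> Poly_Mapping.keys (f' * Poly_Mapping.single \<nu> 1) \<or> k \<in> Poly_Mapping.keys (f' * g')"
      using k Poly_Mapping.keys_add[of "Poly_Mapping.single \<mu> 1 * g' + f' * Poly_Mapping.single \<nu> 1" "f' * g'"]
        Poly_Mapping.keys_add[of "Poly_Mapping.single \<mu> 1 * g'" "f' * Poly_Mapping.single \<nu> 1"] by fast
    then show ?thesis
    proof (elim disjE)
      assume "k \<in> Poly_Mapping.keys (Poly_Mapping.single \<mu> (1::complex) * g')"
      then show ?thesis using keys_mult[of "Poly_Mapping.single \<mu> (1::complex)" g'] kg
        by (auto intro: add_strict_left_mono)
    next
      assume "k \<in> Poly_Mapping.keys (f' * Poly_Mapping.single \<nu> 1)"
      then show ?thesis using keys_mult[of f' "Poly_Mapping.single \<nu> (1::complex)"] kf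
        by (auto intro: add_strict_right_mono)
    next
      assume "k \<in> Poly_Mapping.keys (f' * g')"
      then show ?thesis using keys_mult[of f' g'] kf kg
        by (auto intro: add_strict_mono)
    qed
  qed
  then have "Poly_Mapping.lookup ?r (\<mu> + \<nu>) = 0"
    by (metis in_keys_iff less_irrefl)
  then have "Poly_Mapping.lookup (f * g) (\<mu> + \<nu>) = 1"
    unfolding fg lookup_add[of "Poly_Mapping.single (\<mu> + \<nu>) 1"] by simp
  moreover have "k \<le> \<mu> + \<nu>" if "k \<in> Poly_Mapping.keys (f * g)" for k
    using that less Poly_Mapping.keys_add[of "Poly_Mapping.single (\<mu> + \<nu>) (1::complex)" ?r] unfolding fg
    by (auto intro: less_imp_le)
  ultimately show ?thesis by (simp add: has_lead_def)
qed

lemma has_lead_prod: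
  assumes "\<And>x. x \<in> A \<Longrightarrow> has_lead (f x) (\<mu> x)"
  shows "has_lead (\<Prod>x\<in>A. f x) (\<Sum>x\<in>A. \<mu> x)"
  using assms by (induction A rule: infinite_finite_induct) (auto intro: has_lead_1 has_lead_mult)

text \<open>Several \<open>t\<close> may share an exponent, but none shares the maximal one with
  \<open>t0\<close>, so its coefficient survives.\<close>

lemma has_lead_sum_single:
  assumes "finite T" "t0 \<in> T" "c t0 = 1" "\<And>t. t \<in> T \<Longrightarrow> t \<noteq> t0 \<Longrightarrow> \<mu> t < \<mu> t0"
  shows "has_lead (\<Sum>t\<in>T. Poly_Mapping.single (\<mu> t) (c t)) (\<mu> t0)"
proof -
  have "Poly_Mapping.lookup (\<Sum>t\<in>T. Poly_Mapping.single (\<mu> t) (c t)) (\<mu> t0) =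
      (\<Sum>t\<in>T. if t = t0 then 1 else 0)"
    unfolding lookup_sum using assms by (intro sum.cong) (force simp: lookup_single when_def)+
  moreover have "k \<le> \<mu> t0" if k: "k \<in> Poly_Mapping.keys (\<Sum>t\<in>T. Poly_Mapping.single (\<mu> t) (c t))" for k
  proof -
    have "(\<Sum>t\<in>T. Poly_Mapping.lookup (Poly_Mapping.single (\<mu> t) (c t)) k) \<noteq> 0"
      using k by (simp add: in_keys_iff lookup_sum)
    then obtain t where "t \<in> T" "Poly_Mapping.lookup (Poly_Mapping.single (\<mu> t) (c t)) k \<noteq> 0"
      by (meson sum.neutral)
    then show ?thesis using assms(4)[of t] by (cases "t = t0") (auto simp: lookup_single when_def less_imp_le split: if_splits)
  qed
  ultimately show ?thesis using assms by (simp add: has_lead_def)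
qed

section \<open>Integrality of coefficients\<close>

definition integral_poly :: "('b \<Rightarrow>\<^sub>0 complex) \<Rightarrow> bool" where
  "integral_poly f \<longleftrightarrow> (\<forall>k. Poly_Mapping.lookup f k \<in> \<int>)"

lemma integral_poly_single: "c \<in> \<int> \<Longrightarrow> integral_poly (Poly_Mapping.single k c)"
  by (simp add: integral_poly_def lookup_single when_def)

lemma integral_poly_1: "integral_poly (1 :: 'b::zero \<Rightarrow>\<^sub>0 complex)"
  using integral_poly_single[of 1 0] by simp

lemma integral_poly_sum: "(\<And>x. x \<in> A \<Longrightarrow> integral_poly (f x)) \<Longrightarrow> integral_poly (sum f A)"
  by (auto simp: integral_poly_def lookup_sum)

lemma integral_poly_mult:
  fixes f g :: "'b::comm_monoid_add \<Rightarrow>\<^sub>0 complex"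
  assumes "integral_poly f" "integral_poly g"
  shows "integral_poly (f * g)"
proof -
  have "f * g = (\<Sum>k\<in>Poly_Mapping.keys f. \<Sum>l\<in>Poly_Mapping.keys g.
      Poly_Mapping.single (k + l) (Poly_Mapping.lookup f k * Poly_Mapping.lookup g l))"
    by (subst poly_mapping_eq_sum_single[of f], subst poly_mapping_eq_sum_single[of g])
       (simp only: sum_product mult_single)
  then show ?thesis
    using assms by (auto simp: integral_poly_def intro!: integral_poly_sum[unfolded integral_poly_def, rule_format]
        integral_poly_single[unfolded integral_poly_def, rule_format])
qed

lemma integral_poly_prod:
  fixes f :: "'a \<Rightarrow> 'b::comm_monoid_add \<Rightarrow>\<^sub>0 complex"
  shows "(\<And>x. x \<in> A \<Longrightarrow> integral_poly (f x)) \<Longrightarrow> integral_poly (prod f A)"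
  by (induction A rule: infinite_finite_induct) (auto intro: integral_poly_1 integral_poly_mult)

lemma integral_poly_prod_mset:
  fixes f :: "'a \<Rightarrow> 'b::comm_monoid_add \<Rightarrow>\<^sub>0 complex"
  shows "(\<And>x. x \<in># A \<Longrightarrow> integral_poly (f x)) \<Longrightarrow> integral_poly (\<Prod>x\<in>#A. f x)"
  by (induction A) (auto intro: integral_poly_1 integral_poly_mult)

lemma signof_poly: "(signof p :: 'b::comm_monoid_add \<Rightarrow>\<^sub>0 complex) = Poly_Mapping.single 0 (signof p)"
  by (cases p rule: sign_cases) (simp_all add: single_uminus)

lemma integral_poly_det:
  fixes A :: "('b::comm_monoid_add \<Rightarrow>\<^sub>0 complex) mat"
  assumes "\<And>i j. i < dim_row A \<Longrightarrow> j < dim_col A \<Longrightarrow> integral_poly (A $$ (i, j))"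
  shows "integral_poly (det A)"
proof (cases "dim_row A = dim_col A")
  case True
  have "integral_poly (signof p * (\<Prod>i = 0..<dim_row A. A $$ (i, p i)))"
    if "p permutes {0..<dim_row A}" for p
  proof (intro integral_poly_mult integral_poly_prod)
    show "integral_poly (signof p :: 'b \<Rightarrow>\<^sub>0 complex)"
      unfolding signof_poly by (rule integral_poly_single) simp
    show "integral_poly (A $$ (i, p i))" if "i \<in> {0..<dim_row A}" for i
      using that assms \<open>p permutes _\<close> permutes_in_image[of p] True by fastforce
  qed
  then show ?thesis using True by (auto simp: det_def intro!: integral_poly_sum)
qed (auto simp: det_def integral_poly_def)

section \<open>Leading monomials of minors\<close>

type_synonym fvar = "nat \<times> nat \<times> nat"

text \<open>In the order on \<open>fvar \<Rightarrow>\<^sub>0 nat\<close> the smallest variable is the most significant one. An injective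
  \<open>\<kappa>\<close> therefore does best by choosing the least index not yet taken, that is by the identity.\<close>

definition diag_exp :: "nat \<Rightarrow> nat list \<Rightarrow> (nat \<Rightarrow> nat) \<Rightarrow> fvar \<Rightarrow>\<^sub>0 nat" where
  "diag_exp t is \<kappa> = (\<Sum>a<length is. Poly_Mapping.single (t, is ! a, \<kappa> a) 1)"

lemma diag_exp_cong: "(\<And>a. a < length is \<Longrightarrow> \<kappa> a = \<kappa>' a) \<Longrightarrow> diag_exp t is \<kappa> = diag_exp t is \<kappa>'"
  by (simp add: diag_exp_def)

lemma diag_exp_less:
  assumes "sorted_wrt (<) is" "inj_on \<kappa> {..<length is}" "b < length is" "\<kappa> b \<noteq> b"
  shows "diag_exp t is \<kappa> < diag_exp t is id"
proof -
  define a where "a = (LEAST a. a < length is \<and> \<kappa> a \<noteq> a)"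
  have a: "a < length is" "\<kappa> a \<noteq> a"
    using LeastI[of "\<lambda>a. a < length is \<and> \<kappa> a \<noteq> a" b] assms(3,4) unfolding a_def by auto
  have least: "\<kappa> c = c" if "c < a" for c
    using that not_less_Least[of c "\<lambda>a. a < length is \<and> \<kappa> a \<noteq> a"] a unfolding a_def[symmetric] by simp
  \<comment> \<open>All values below \<open>a\<close> are already taken at earlier positions, so
    injectivity pushes \<open>\<kappa> a\<close> above \<open>a\<close>.\<close>
  have gt: "a < \<kappa> a"
  proof (rule ccontr)
    assume "\<not> a < \<kappa> a"
    then have "\<kappa> a < a" using a by simp
    then have "\<kappa> (\<kappa> a) = \<kappa> a" by (rule least)
    then show False using assms(2) a \<open>\<kappa> a < a\<close> by (auto dest!: inj_onD)
  qed
  have strict: "is ! c < is ! c'" if "c < c'" "c' < length is" for c c'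
    using assms(1) that by (simp add: sorted_wrt_iff_nth_less)
  have look: "Poly_Mapping.lookup (diag_exp t is f) v = (\<Sum>c<length is. if (t, is ! c, f c) = v then 1 else (0::nat))" for f v
    by (simp add: diag_exp_def lookup_sum lookup_single when_def del: One_nat_def)
  \<comment> \<open>The variable that decides the comparison: it occurs for the identity but not for
    \<open>\<kappa>\<close>, while all smaller variables have equal exponents.\<close>
  let ?v = "(t, is ! a, a)"
  have "Poly_Mapping.lookup (diag_exp t is \<kappa>) ?v = 0"
    unfolding look
  proof (intro sum.neutral ballI)
    fix c assume "c \<in> {..<length is}"
    then show "(if (t, is ! c, \<kappa> c) = ?v then 1 else 0) = (0::nat)"
      using strict[of c a] strict[of a c] a by (cases c a rule: linorder_cases) auto
  qed
  moreover have "Poly_Mapping.lookup (diag_exp t is id) ?v > 0"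
    unfolding look using a by (intro sum_pos2[of _ a]) auto
  moreover have "Poly_Mapping.lookup (diag_exp t is \<kappa>) v = Poly_Mapping.lookup (diag_exp t is id) v" if "v < ?v" for v
    unfolding look
  proof (rule sum.cong[OF refl])
    fix c assume c: "c \<in> {..<length is}"
    show "(if (t, is ! c, \<kappa> c) = v then 1 else 0) = (if (t, is ! c, id c) = v then 1 else (0::nat))"
    proof (cases "c < a")
      case True
      then show ?thesis by (simp add: least)
    next
      case False
      then have "is ! c > is ! a \<or> c = a" using strict[of a c] c by (cases "c = a") auto
      then show ?thesis using that gt by (auto simp: less_prod_def less_eq_prod_def)
    qed
  qed
  ultimately show ?thesis
    unfolding less_poly_mapping.rep_eq less_fun_def by metis
qed

lemma diag_exp_le:
  assumes "sorted_wrt (<) is" "inj_on \<kappa> {..<length is}"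
  shows "diag_exp t is \<kappa> \<le> diag_exp t is id"
proof (cases "\<forall>a<length is. \<kappa> a = a")
  case True
  then show ?thesis using diag_exp_cong[of "is" \<kappa> id] by simp
next
  case False
  then show ?thesis using diag_exp_less[OF assms] by (auto intro: less_imp_le)
qed

definition fmono :: "(fvar \<Rightarrow>\<^sub>0 nat) \<Rightarrow> (fvar \<Rightarrow>\<^sub>0 nat) \<Rightarrow>\<^sub>0 complex" where
  "fmono \<mu> = Poly_Mapping.single \<mu> 1"

lemma fmono_add: "fmono (\<mu> + \<nu>) = fmono \<mu> * fmono \<nu>"
  by (simp add: fmono_def mult_single)

lemma fmono_sum: "fmono (sum f A) = (\<Prod>a\<in>A. fmono (f a))"
  by (induction A rule: infinite_finite_induct) (auto simp: fmono_add, simp_all add: fmono_def)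

definition factor_var :: "nat \<Rightarrow> nat \<Rightarrow> nat \<Rightarrow> (fvar \<Rightarrow>\<^sub>0 nat) \<Rightarrow>\<^sub>0 complex" where
  "factor_var t i k = fmono (Poly_Mapping.single (t, i, k) 1)"

text \<open>The substitution \<open>Z = X Y\<close> for generic matrices \<open>X\<close> and \<open>Y\<close> of sizes \<open>m \<times> N\<close> and \<open>N \<times> n\<close>;
  \<open>(0, i, k)\<close> and \<open>(1, j, k)\<close> stand for \<open>x\<^sub>i\<^sub>k\<close> and \<open>y\<^sub>k\<^sub>j\<close>.\<close>

definition factor_subst :: "nat \<Rightarrow> zpoly \<Rightarrow> (fvar \<Rightarrow>\<^sub>0 nat) \<Rightarrow>\<^sub>0 complex" where
  "factor_subst N = poly_subst (\<lambda>(i, j). \<Sum>k<N. factor_var 0 i k * factor_var 1 j k)"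

lemma comm_ring_hom_factor_subst: "comm_ring_hom (factor_subst N)"
  unfolding factor_subst_def by (rule comm_ring_hom_poly_subst)

lemma factor_subst_zvar: "factor_subst N (zvar i j) = (\<Sum>k<N. factor_var 0 i k * factor_var 1 j k)"
  by (simp add: factor_subst_def zvar_def monomial_def poly_subst_single)

lemma prod_factor_var: "(\<Prod>a<length is. factor_var t (is ! a) (\<kappa> a)) = fmono (diag_exp t is \<kappa>)"
  by (simp add: factor_var_def diag_exp_def fmono_sum)

text \<open>The part of the Cauchy--Binet formula needed here: a non-injective \<open>\<kappa>\<close> produces two equal rows.\<close>

lemma det_product_expand:
  fixes f :: "nat \<Rightarrow> nat \<Rightarrow> 'a::comm_ring_1" and g :: "nat \<Rightarrow> nat \<Rightarrow> 'a"
  shows "det (mat r r (\<lambda>(a, b). \<Sum>k<N. f a k * g k b)) =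
    (\<Sum>\<kappa>\<in>{\<kappa> \<in> {..<r} \<rightarrow>\<^sub>E {..<N}. inj_on \<kappa> {..<r}}.
       (\<Prod>a<r. f a (\<kappa> a)) * det (mat r r (\<lambda>(a, b). g (\<kappa> a) b)))"
proof -
  have pm: "p a < r" if "p permutes {0..<r}" "a < r" for p a
    using permutes_in_image[OF that(1), of a] that(2) by simp
  have d: "det (mat r r (\<lambda>(a, b). h a b)) =
      (\<Sum>p | p permutes {0..<r}. signof p * (\<Prod>a<r. h a (p a)))" for h :: "nat \<Rightarrow> nat \<Rightarrow> 'a"
    by (subst det_def'[of _ r]) (auto intro!: sum.cong prod.cong simp: pm lessThan_atLeast0)
  have "det (mat r r (\<lambda>(a, b). \<Sum>k<N. f a k * g k b)) =
      (\<Sum>p | p permutes {0..<r}. signof p *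
         (\<Sum>\<kappa>\<in>{..<r} \<rightarrow>\<^sub>E {..<N}. \<Prod>a<r. f a (\<kappa> a) * g (\<kappa> a) (p a)))"
    by (simp only: d prod_sum_PiE[OF finite_lessThan finite_lessThan])
  also have "\<dots> = (\<Sum>\<kappa>\<in>{..<r} \<rightarrow>\<^sub>E {..<N}. \<Sum>p | p permutes {0..<r}.
         signof p * (\<Prod>a<r. f a (\<kappa> a) * g (\<kappa> a) (p a)))"
    unfolding sum_distrib_left by (rule sum.swap)
  also have "\<dots> = (\<Sum>\<kappa>\<in>{..<r} \<rightarrow>\<^sub>E {..<N}.
       (\<Prod>a<r. f a (\<kappa> a)) * det (mat r r (\<lambda>(a, b). g (\<kappa> a) b)))"
    by (simp add: d prod.distrib sum_distrib_left mult_ac)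
  also have "\<dots> = (\<Sum>\<kappa>\<in>{\<kappa> \<in> {..<r} \<rightarrow>\<^sub>E {..<N}. inj_on \<kappa> {..<r}}.
       (\<Prod>a<r. f a (\<kappa> a)) * det (mat r r (\<lambda>(a, b). g (\<kappa> a) b)))"
  proof (rule sum.mono_neutral_right)
    show "\<forall>\<kappa>\<in>({..<r} \<rightarrow>\<^sub>E {..<N}) - {\<kappa> \<in> {..<r} \<rightarrow>\<^sub>E {..<N}. inj_on \<kappa> {..<r}}.
        (\<Prod>a<r. f a (\<kappa> a)) * det (mat r r (\<lambda>(a, b). g (\<kappa> a) b)) = 0"
    proof
      fix \<kappa> assume "\<kappa> \<in> ({..<r} \<rightarrow>\<^sub>E {..<N}) - {\<kappa> \<in> {..<r} \<rightarrow>\<^sub>E {..<N}. inj_on \<kappa> {..<r}}"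
      then obtain a b where "a < r" "b < r" "a \<noteq> b" "\<kappa> a = \<kappa> b"
        by (auto simp: inj_on_def)
      then have "det (mat r r (\<lambda>(a, b). g (\<kappa> a) b)) = 0"
        by (intro det_identical_rows[of _ r a b]) (auto intro!: eq_vecI)
      then show "(\<Prod>a<r. f a (\<kappa> a)) * det (mat r r (\<lambda>(a, b). g (\<kappa> a) b)) = 0" by simp
    qed
  qed (auto intro: finite_PiE)
  finally show ?thesis .
qed

text \<open>The Leibniz formula also expands the determinant of the second factor. Reindexing along
  \<open>p\<close> attaches the inner index \<open>\<kappa> (inv_into UNIV p b)\<close> to the
  column label \<open>js ! b\<close>.\<close>

lemma factor_subst_minor:
  assumes "length is = r" "length js = r"
  shows "factor_subst N (minor is js) =
    (\<Sum>(\<kappa>, p)\<in>{\<kappa> \<in> {..<r} \<rightarrow>\<^sub>E {..<N}. inj_on \<kappa> {..<r}} \<times> {p. p permutes {0..<r}}.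
      Poly_Mapping.single (diag_exp 0 is \<kappa> + diag_exp 1 js (\<kappa> \<circ> inv_into UNIV p)) (signof p))"
proof -
  interpret h: comm_ring_hom "factor_subst N" by (rule comm_ring_hom_factor_subst)
  have pm: "p a < r" if "p permutes {0..<r}" "a < r" for p a
    using permutes_in_image[OF that(1), of a] that(2) by simp
  have Y: "det (mat r r (\<lambda>(a, b). factor_var 1 (js ! b) (\<kappa> a))) =
      (\<Sum>p | p permutes {0..<r}. signof p * fmono (diag_exp 1 js (\<kappa> \<circ> inv_into UNIV p)))" for \<kappa>
  proof -
    have "(\<Prod>a = 0..<r. factor_var 1 (js ! p a) (\<kappa> a)) = fmono (diag_exp 1 js (\<kappa> \<circ> inv_into UNIV p))"
      if p: "p permutes {0..<r}" for p
    proof -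
      have "(\<Prod>a = 0..<r. factor_var 1 (js ! p a) (\<kappa> a)) =
          (\<Prod>a = 0..<r. factor_var 1 (js ! p a) ((\<kappa> \<circ> inv_into UNIV p) (p a)))"
        by (simp add: permutes_inverses[OF p])
      also have "\<dots> = (\<Prod>b = 0..<r. factor_var 1 (js ! b) ((\<kappa> \<circ> inv_into UNIV p) b))"
        using prod.permute[OF p, of "\<lambda>b. factor_var 1 (js ! b) ((\<kappa> \<circ> inv_into UNIV p) b)"] by (simp add: comp_def)
      finally show ?thesis using prod_factor_var[of 1 js "\<kappa> \<circ> inv_into UNIV p"] assms by (simp add: lessThan_atLeast0)
    qed
    then show ?thesis
      by (subst det_def'[of _ r]) (auto intro!: sum.cong simp: pm)
  qed
  have sg: "fmono \<mu> * (signof p * fmono \<nu>) = Poly_Mapping.single (\<mu> + \<nu>) (signof p)" for \<mu> \<nu> p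
    unfolding signof_poly fmono_def mult_single by simp
  have "factor_subst N (minor is js) =
      det (mat r r (\<lambda>(a, b). \<Sum>k<N. factor_var 0 (is ! a) k * factor_var 1 (js ! b) k))"
  proof -
    have "map_mat (factor_subst N) (mat r r (\<lambda>(a, b). zvar (is ! a) (js ! b))) =
      mat r r (\<lambda>(a, b). \<Sum>k<N. factor_var 0 (is ! a) k * factor_var 1 (js ! b) k)"
      by (rule eq_matI) (auto simp: factor_subst_zvar)
    then show ?thesis unfolding minor_def assms by (metis h.hom_det)
  qed
  also have "\<dots> = (\<Sum>\<kappa>\<in>{\<kappa> \<in> {..<r} \<rightarrow>\<^sub>E {..<N}. inj_on \<kappa> {..<r}}.
      \<Sum>p | p permutes {0..<r}. fmono (diag_exp 0 is \<kappa>) * (signof p * fmono (diag_exp 1 js (\<kappa> \<circ> inv_into UNIV p))))"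
    unfolding det_product_expand Y sum_distrib_left prod_factor_var[of _ "is", unfolded assms] ..
  also have "\<dots> = (\<Sum>(\<kappa>, p)\<in>{\<kappa> \<in> {..<r} \<rightarrow>\<^sub>E {..<N}. inj_on \<kappa> {..<r}} \<times> {p. p permutes {0..<r}}.
      fmono (diag_exp 0 is \<kappa>) * (signof p * fmono (diag_exp 1 js (\<kappa> \<circ> inv_into UNIV p))))"
    by (rule sum.cartesian_product)
  finally show ?thesis unfolding sg .
qed

text \<open>The x-part is maximal only when \<open>\<kappa>\<close> is the identity, and then the
  y-part only when \<open>p\<close> is. Exactly one term attains the bound, with sign 1;
  \<open>length is \<le> N\<close> makes the identity an admissible choice.\<close>

lemma has_lead_minor:
  assumes "sorted_wrt (<) is" "sorted_wrt (<) js" "length is = length js" "length is \<le> N"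
  shows "has_lead (factor_subst N (minor is js)) (diag_exp 0 is id + diag_exp 1 js id)"
proof -
  let ?r = "length is"
  let ?K = "{\<kappa> \<in> {..<?r} \<rightarrow>\<^sub>E {..<N}. inj_on \<kappa> {..<?r}}"
  let ?p0 = "id :: nat \<Rightarrow> nat"
  \<comment> \<open>The identity is restricted in order to lie in the extensional function
    space.\<close>
  let ?k0 = "restrict id {..<?r}"
  let ?\<mu> = "\<lambda>(\<kappa>, p). diag_exp 0 is \<kappa> + diag_exp 1 js (\<kappa> \<circ> inv_into UNIV p)"
  let ?T = "?K \<times> {p. p permutes {0..<?r}}"
  have k0: "?\<mu> (?k0, ?p0) = diag_exp 0 is id + diag_exp 1 js id"
    using diag_exp_cong[of "is" ?k0 id] diag_exp_cong[of js "?k0 \<circ> inv_into UNIV ?p0" id] assms by simp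
  have "has_lead (\<Sum>t\<in>?T. Poly_Mapping.single (?\<mu> t) (signof (snd t))) (?\<mu> (?k0, ?p0))"
  proof (rule has_lead_sum_single)
    have "finite ?K" by (rule finite_subset[of _ "{..<?r} \<rightarrow>\<^sub>E {..<N}"]) (auto intro: finite_PiE)
    then show "finite ?T" by (simp add: finite_permutations)
    show "(?k0, ?p0) \<in> ?T" using assms(4) by (auto simp: inj_on_def permutes_id)
    show "complex_of_int (sign (snd (?k0, ?p0))) = 1" by simp
    fix t assume t: "t \<in> ?T" "t \<noteq> (?k0, ?p0)"
    obtain \<kappa> p where tp: "t = (\<kappa>, p)" by (cases t)
    have p: "p permutes {..<?r}" and \<kappa>: "\<kappa> \<in> {..<?r} \<rightarrow>\<^sub>E {..<N}" "inj_on \<kappa> {..<?r}"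
      using t tp by (auto simp: lessThan_atLeast0)
    have ip: "inv_into UNIV p permutes {..<?r}" using p by (rule permutes_inv)
    have inj: "inj_on (\<kappa> \<circ> inv_into UNIV p) {..<length js}"
      using \<kappa>(2) ip assms(3) by (metis comp_inj_on permutes_image permutes_inj_on)
    have le: "diag_exp 0 is \<kappa> \<le> diag_exp 0 is id" "diag_exp 1 js (\<kappa> \<circ> inv_into UNIV p) \<le> diag_exp 1 js id"
      using diag_exp_le[OF assms(1) \<kappa>(2)] diag_exp_le[OF assms(2) inj] by auto
    show "?\<mu> t < ?\<mu> (?k0, ?p0)"
    proof (cases "\<forall>a<?r. \<kappa> a = a")
      case False
      then have "diag_exp 0 is \<kappa> < diag_exp 0 is id"
        using diag_exp_less[OF assms(1) \<kappa>(2)] by blast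
      then show ?thesis unfolding k0 tp using le by (simp add: add_less_le_mono)
    next
      case True
      then have "\<kappa> = ?k0" using \<kappa>(1) by (intro extensionalityI[of _ "{..<?r}"]) (auto simp: PiE_def)
      then have "p \<noteq> id" using t tp by simp
      then have "inv_into UNIV p \<noteq> id" using p by (metis inv_id inv_inv_eq permutes_bij)
      then obtain b where b: "inv_into UNIV p b \<noteq> b" by (auto simp: fun_eq_iff)
      then have "b < ?r" using ip by (metis lessThan_iff permutes_not_in)
      moreover from this have "(\<kappa> \<circ> inv_into UNIV p) b \<noteq> b"
        using b True permutes_in_image[OF ip, of b] by simp
      ultimately have "diag_exp 1 js (\<kappa> \<circ> inv_into UNIV p) < diag_exp 1 js id"
        using diag_exp_less[OF assms(2) inj, of b] assms(3) by simp
      then show ?thesis unfolding k0 tp using le by (simp add: add_le_less_mono)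
    qed
  qed
  then show ?thesis
    unfolding k0 factor_subst_minor[OF refl assms(3)[symmetric]] by (simp add: case_prod_unfold)
qed

section \<open>Leading monomials of bitableaux\<close>

lemma column_Nil [simp]: "column [] c = []"
  by (simp add: column_def)

lemma column_Cons: "column (r # T) c = (if c < length r then r ! c # column T c else column T c)"
  by (simp add: column_def)

lemma column_empty: "\<forall>r\<in>set T. length r \<le> c \<Longrightarrow> column T c = []"
  by (simp add: column_def filter_empty_conv not_less)

lemma length_column: "length (column T c) = length (filter (\<lambda>l. c < l) (map length T))"
  by (simp add: column_def filter_map comp_def)

lemma length_column_le: "length (column T c) \<le> length T"
  by (simp add: column_def)

lemma sorted_column:
  assumes "sorted_wrt row_above T"
  shows "sorted_wrt (<) (column T c)"
  using assms
proof (induction T)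
  case (Cons r T)
  then have "r ! c < x" if "x \<in> set (column T c)" for x
    using that by (auto simp: column_def row_above_def)
  with Cons show ?case by (auto simp: column_Cons)
qed simp

lemma sum_mset_nth: "(\<Sum>c<length r. g (r ! c)) = (\<Sum>x\<in>#mset r. g x)"
proof -
  have "(\<Sum>x\<in>#mset r. g x) = sum_list (map g r)"
    by (metis mset_map sum_mset_sum_list)
  then show ?thesis by (simp add: sum_list_sum_nth atLeast0LessThan)
qed

text \<open>Both sides sum over all boxes, by columns and by rows. The offset \<open>s\<close>
  serves the induction: removing the top row shifts the row numbers by one.\<close>

lemma sum_columns:
  fixes g :: "nat \<Rightarrow> nat \<Rightarrow> 'a::comm_monoid_add"
  assumes "sorted_wrt row_above T" "\<forall>r\<in>set T. length r \<le> L"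
  shows "(\<Sum>c<L. \<Sum>a<length (column T c). g (column T c ! a) (s + a)) =
    (\<Sum>k<length T. \<Sum>x\<in>#mset (T ! k). g x (s + k))"
  using assms
proof (induction T arbitrary: s)
  case Nil
  then show ?case by simp
next
  case (Cons r T)
  have "(\<Sum>a<length (column (r # T) c). g (column (r # T) c ! a) (s + a)) =
      (if c < length r then g (r ! c) s else 0) +
      (\<Sum>a<length (column T c). g (column T c ! a) (Suc s + a))" for c
  proof (cases "c < length r")
    case True
    then show ?thesis by (simp add: column_Cons sum.lessThan_Suc_shift del: sum.lessThan_Suc)
  next
    case False
    \<comment> \<open>No lower row is longer than the top one.\<close>
    then have "column T c = []"
      using Cons.prems by (intro column_empty) (force simp: row_above_def)
    then show ?thesis using False by (simp add: column_Cons)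
  qed
  then have "(\<Sum>c<L. \<Sum>a<length (column (r # T) c). g (column (r # T) c ! a) (s + a)) =
      (\<Sum>c<L. if c < length r then g (r ! c) s else 0) +
      (\<Sum>c<L. \<Sum>a<length (column T c). g (column T c ! a) (Suc s + a))"
    by (simp only: sum.distrib)
  also have "(\<Sum>c<L. if c < length r then g (r ! c) s else 0) = (\<Sum>c<length r. g (r ! c) s)"
    using Cons.prems(2) by (intro sum.mono_neutral_cong_right) auto
  also have "\<dots> = (\<Sum>x\<in>#mset r. g x s)"
    by (rule sum_mset_nth)
  also have "(\<Sum>c<L. \<Sum>a<length (column T c). g (column T c ! a) (Suc s + a)) =
      (\<Sum>k<length T. \<Sum>x\<in>#mset (T ! k). g x (Suc s + k))"
    using Cons.prems by (intro Cons.IH) auto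
  finally show ?case by (simp add: sum.lessThan_Suc_shift del: sum.lessThan_Suc)
qed

definition num_columns :: "tableau \<Rightarrow> nat" where
  "num_columns T = (if T = [] then 0 else length (hd T))"

lemma row_length_le_num_columns:
  "sorted_wrt row_above T \<Longrightarrow> \<forall>r\<in>set T. length r \<le> num_columns T"
  by (cases T) (auto simp: num_columns_def row_above_def)

definition tab_exp :: "nat \<Rightarrow> tableau \<Rightarrow> fvar \<Rightarrow>\<^sub>0 nat" where
  "tab_exp t T = (\<Sum>k<length T. \<Sum>x\<in>#mset (T ! k). Poly_Mapping.single (t, x, k) 1)"

lemma sum_diag_exp_columns:
  assumes "sorted_wrt row_above T"
  shows "(\<Sum>c<num_columns T. diag_exp t (column T c) id) = tab_exp t T"
  using sum_columns[OF assms row_length_le_num_columns[OF assms], of "\<lambda>x k. Poly_Mapping.single (t, x, k) 1" 0]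
  by (simp add: diag_exp_def tab_exp_def del: One_nat_def)

lemma sum_mset_columns:
  assumes "sorted_wrt row_above T"
  shows "(\<Sum>c<num_columns T. mset (column T c)) = mset (concat T)"
proof -
  have s: "(\<Sum>a<length xs. {#xs ! a#}) = mset xs" for xs :: "nat list"
    using sum_mset_nth[of "\<lambda>x. {#x#}" xs] by simp
  have "(\<Sum>k<length T. mset (T ! k)) = mset (concat T)"
    by (simp add: mset_concat sum_list_sum_nth atLeast0LessThan)
  then show ?thesis
    using sum_columns[OF assms row_length_le_num_columns[OF assms], of "\<lambda>x k. {#x#}" 0]
    by (simp add: s)
qed

lemma lookup_sum_mset_single:
  "Poly_Mapping.lookup (\<Sum>x\<in>#M. Poly_Mapping.single (t, x, k) (1::nat)) (t', i, k') =
     (if t = t' \<and> k = k' then count M i else 0)"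
  by (induction M) (auto simp: lookup_add lookup_single when_def)

lemma lookup_tab_exp:
  "Poly_Mapping.lookup (tab_exp t T) (t', i, k) = (if t = t' \<and> k < length T then count (mset (T ! k)) i else 0)"
  unfolding tab_exp_def lookup_sum lookup_sum_mset_single
  by (auto simp: sum.delta' if_distrib cong: conj_cong if_cong)

text \<open>The exponents give the multiset of labels of each row. Rows are nonempty, which fixes
  their number, and sorted, which fixes their order of entries.\<close>

lemma semistandard_eqI:
  assumes "semistandard T" "semistandard T'"
    "\<And>i k. Poly_Mapping.lookup (tab_exp t T) (t, i, k) = Poly_Mapping.lookup (tab_exp t T') (t, i, k)"
  shows "T = T'"
proof -
  have c: "(if k < length T then mset (T ! k) else {#}) = (if k < length T' then mset (T' ! k) else {#})" for k
    using assms(3)[of _ k] by (intro multiset_eqI) (auto simp: lookup_tab_exp split: if_splits)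
  have ne: "k < length U \<Longrightarrow> mset (U ! k) \<noteq> {#} \<and> sorted (U ! k)" if "semistandard U" for U k
    using that by (auto simp: semistandard_def)
  have "k < length T \<longleftrightarrow> k < length T'" for k
    using c[of k] ne[OF assms(1), of k] ne[OF assms(2), of k] by (auto split: if_splits)
  then have "length T = length T'" by (metis linorder_neqE_nat less_irrefl)
  then show ?thesis
  proof (rule nth_equalityI)
    fix k assume k: "k < length T"
    then show "T ! k = T' ! k"
      using c[of k] ne[OF assms(1), of k] ne[OF assms(2), of k] \<open>length T = length T'\<close>
      by (metis properties_for_sort sorted_sort_id)
  qed
qed

text \<open>Leading exponents of the column minors add up, and collecting the boxes by rows instead
  of columns gives \<open>tab_exp\<close>. The bound \<open>N\<close> covers the column heights,
  which are at most \<open>length P\<close>.\<close>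

lemma has_lead_bitableau:
  assumes "semistandard P" "semistandard Q" "map length P = map length Q" "length P \<le> N"
  shows "has_lead (factor_subst N (bitableau P Q)) (tab_exp 0 P + tab_exp 1 Q)"
proof -
  interpret h: comm_ring_hom "factor_subst N" by (rule comm_ring_hom_factor_subst)
  have s: "sorted_wrt row_above P" "sorted_wrt row_above Q" using assms by (auto simp: semistandard_def)
  have n: "num_columns P = num_columns Q"
    using assms(3) by (cases P; cases Q) (auto simp: num_columns_def)
  have lens: "length (column P c) = length (column Q c)" "length (column P c) \<le> N" for c
    using assms(3,4) length_column_le[of P c] by (simp_all add: length_column[of Q] length_column[of P])
  have "has_lead (\<Prod>c<num_columns P. factor_subst N (minor (column P c) (column Q c)))
      (\<Sum>c<num_columns P. diag_exp 0 (column P c) id + diag_exp 1 (column Q c) id)"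
    using s by (intro has_lead_prod has_lead_minor sorted_column lens)
  moreover have "(\<Sum>c<num_columns P. diag_exp 0 (column P c) id + diag_exp 1 (column Q c) id) =
      tab_exp 0 P + tab_exp 1 Q"
    using s by (simp add: sum.distrib sum_diag_exp_columns) (simp add: n sum_diag_exp_columns)
  ultimately show ?thesis
    by (simp add: bitableau_def h.hom_prod num_columns_def)
qed

section \<open>Margins and integrality of bitableaux\<close>

definition homogeneous :: "nat multiset \<Rightarrow> nat multiset \<Rightarrow> zpoly \<Rightarrow> bool" where
  "homogeneous A B f \<longleftrightarrow> (\<forall>\<alpha>\<in>Poly_Mapping.keys f.
     image_mset fst (exp_mset \<alpha>) = A \<and> image_mset snd (exp_mset \<alpha>) = B)"

lemma homogeneous_single_0: "homogeneous {#} {#} (Poly_Mapping.single 0 c)"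
  by (simp add: homogeneous_def)

lemma homogeneous_mult:
  "homogeneous A B f \<Longrightarrow> homogeneous A' B' g \<Longrightarrow> homogeneous (A + A') (B + B') (f * g)"
  unfolding homogeneous_def using keys_mult[of f g] by fastforce

lemma homogeneous_1: "homogeneous {#} {#} 1"
  by (simp add: homogeneous_def)

lemma homogeneous_prod:
  "(\<And>x. x \<in> X \<Longrightarrow> homogeneous (A x) (B x) (f x)) \<Longrightarrow> homogeneous (sum A X) (sum B X) (prod f X)"
  by (induction X rule: infinite_finite_induct)
    (auto intro: homogeneous_mult simp: homogeneous_1)

lemma homogeneous_sum:
  "(\<And>x. x \<in> X \<Longrightarrow> homogeneous A B (f x)) \<Longrightarrow> homogeneous A B (sum f X)"
  unfolding homogeneous_def
proof (induction X rule: infinite_finite_induct)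
  case (insert x X)
  then show ?case using Poly_Mapping.keys_add[of "f x" "sum f X"] by fastforce
qed auto

lemma homogeneous_zvar: "homogeneous {#i#} {#j#} (zvar i j)"
  by (simp add: homogeneous_def zvar_def monomial_def)

text \<open>Each Leibniz term uses every row label and every column label once; \<open>p\<close>
  only permutes the latter.\<close>

lemma homogeneous_minor:
  assumes "length is = length js"
  shows "homogeneous (mset is) (mset js) (minor is js)"
proof -
  let ?r = "length is"
  have s: "(\<Sum>a = 0..<length xs. {#xs ! a#}) = mset xs" for xs :: "nat list"
    using sum_mset_nth[of "\<lambda>x. {#x#}" xs] by (simp add: lessThan_atLeast0)
  have "homogeneous (mset is) (mset js) (signof p * (\<Prod>a = 0..<?r. mat ?r (length js) (\<lambda>(a, b). zvar (is ! a) (js ! b)) $$ (a, p a)))"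
    if p: "p permutes {0..<?r}" for p
  proof -
    have pm: "a < ?r \<Longrightarrow> p a < ?r" for a
      using permutes_in_image[OF p, of a] by simp
    have "homogeneous (\<Sum>a = 0..<?r. {#is ! a#}) (\<Sum>a = 0..<?r. {#js ! p a#})
        (\<Prod>a = 0..<?r. mat ?r (length js) (\<lambda>(a, b). zvar (is ! a) (js ! b)) $$ (a, p a))"
      using pm assms by (intro homogeneous_prod) (auto simp: homogeneous_zvar)
    moreover have "(\<Sum>a = 0..<?r. {#js ! p a#}) = mset js"
      using sum.permute[OF p, of "\<lambda>a. {#js ! a#}"] s[of js] assms by (simp add: comp_def)
    ultimately show ?thesis
      using homogeneous_mult[OF homogeneous_single_0[of "signof p"]] s[of "is"]
      unfolding signof_poly by fastforce
  qed
  then show ?thesis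
    unfolding minor_def det_def using assms by (auto intro!: homogeneous_sum)
qed

lemma homogeneous_bitableau:
  assumes "semistandard P" "semistandard Q" "map length P = map length Q"
  shows "homogeneous (mset (concat P)) (mset (concat Q)) (bitableau P Q)"
proof -
  have s: "sorted_wrt row_above P" "sorted_wrt row_above Q" using assms by (auto simp: semistandard_def)
  have n: "num_columns P = num_columns Q"
    using assms(3) by (cases P; cases Q) (auto simp: num_columns_def)
  have "homogeneous (\<Sum>c<num_columns P. mset (column P c)) (\<Sum>c<num_columns P. mset (column Q c))
      (\<Prod>c<num_columns P. minor (column P c) (column Q c))"
    using assms(3) by (intro homogeneous_prod homogeneous_minor) (simp add: length_column)
  then show ?thesis
    using sum_mset_columns[OF s(1)] sum_mset_columns[OF s(2)]
    by (simp add: n[symmetric] bitableau_def flip: num_columns_def)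
qed

lemma integral_zvar: "integral_poly (zvar i j)"
  by (simp add: zvar_def monomial_def integral_poly_single)

lemma integral_bitableau: "integral_poly (bitableau P Q)"
  unfolding bitableau_def minor_def
  by (intro integral_poly_prod integral_poly_det) (auto simp: integral_zvar)

lemma integral_factor_subst_monomial: "integral_poly (factor_subst N (monomial \<alpha>))"
  unfolding factor_subst_def monomial_def poly_subst_single
  by (auto intro!: integral_poly_mult integral_poly_prod_mset integral_poly_sum integral_poly_single
      simp: factor_var_def fmono_def)

text \<open>Linearity of the substitution, in the form of an entry of a matrix product: with a
  bitableau for \<open>f\<close> it computes \<open>C * M\<close>.\<close>

lemma factor_subst_expand:
  assumes "finite S" "Poly_Mapping.keys f \<subseteq> S"
  shows "Poly_Mapping.lookup (factor_subst N f) \<mu> =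
    (\<Sum>\<beta>\<in>S. Poly_Mapping.lookup (factor_subst N (monomial \<beta>)) \<mu> * Poly_Mapping.lookup f \<beta>)"
proof -
  have l: "Poly_Mapping.lookup (Poly_Mapping.single 0 c * g) \<mu> = c * Poly_Mapping.lookup g \<mu>"
    for c and g :: "(fvar \<Rightarrow>\<^sub>0 nat) \<Rightarrow>\<^sub>0 complex"
    by (simp flip: mult_map_scale_conv_mult add: Poly_Mapping.map.rep_eq when_def)
  show ?thesis
    unfolding factor_subst_def poly_subst_superset[OF assms] monomial_def poly_subst_single lookup_sum l
    by (simp add: mult.commute)
qed

section \<open>Unimodularity and rational eigenvalues\<close>

text \<open>The eigenvalue is a root of the characteristic polynomial, which is monic with integer
  coefficients.\<close>

lemma int_mat_rational_eigenvalue: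
  fixes A :: "int mat" and c :: complex
  assumes A: "A \<in> carrier_mat r r" and ev: "eigenvalue (map_mat of_int A) c" and "c \<in> \<rat>"
  shows "c \<in> \<int>"
proof -
  have m: "degree (char_poly A) = r" "coeff (char_poly A) r = 1" 
    using degree_monic_char_poly[OF A] by auto
  have "poly (map_poly of_int (char_poly A)) c = 0"
    using ev eigenvalue_root_char_poly[of "map_mat of_int A" r c] A
    by (simp add: of_int_hom.char_poly_hom[OF A])
  then have "algebraic_int c"
    unfolding algebraic_int_altdef_ipoly using m by blast
  then show ?thesis using \<open>c \<in> \<rat>\<close> by (rule rational_algebraic_int_is_int)
qed

lemma unimodular_rational_eigenvalue:
  fixes M C :: "int mat" and c :: complex
  assumes M: "M \<in> carrier_mat r r" and C: "C \<in> carrier_mat r r" and det: "det (C * M) = 1"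
    and ev: "eigenvector (map_mat of_int M) v c" and "c \<in> \<rat>"
  shows "c = 1 \<or> c = -1"
proof -
  let ?h = "map_mat (of_int :: int \<Rightarrow> complex)"
  \<comment> \<open>With determinant 1 the adjugate inverts \<open>C * M\<close> over the integers,
    so \<open>N\<close> is an integer left inverse of \<open>M\<close>.\<close>
  define N where "N = adj_mat (C * M) * C"
  have CM: "C * M \<in> carrier_mat r r" using C M by simp
  have adj: "adj_mat (C * M) \<in> carrier_mat r r" "adj_mat (C * M) * (C * M) = 1\<^sub>m r"
    using adj_mat[OF CM] det by auto
  have N: "N \<in> carrier_mat r r" using adj C by (simp add: N_def)
  have NM: "N * M = 1\<^sub>m r"
    using adj C M by (simp add: N_def assoc_mult_mat[of _ r r _ r _ r])
  have v: "v \<in> carrier_vec r" "v \<noteq> 0\<^sub>v r" "?h M *\<^sub>v v = c \<cdot>\<^sub>v v"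
    using ev M by (auto simp: eigenvector_def)
  have "v = (?h N * ?h M) *\<^sub>v v"
    using NM v(1) by (simp flip: of_int_hom.mat_hom_mult[OF N M] add: of_int_hom.mat_hom_one)
  also have "\<dots> = ?h N *\<^sub>v (c \<cdot>\<^sub>v v)"
    using v N M by (simp add: assoc_mult_mat_vec[of _ r r _ r])
  also have "\<dots> = c \<cdot>\<^sub>v (?h N *\<^sub>v v)"
    using v N by (simp add: mult_mat_vec[of _ r r])
  finally have vN: "v = c \<cdot>\<^sub>v (?h N *\<^sub>v v)" .
  have Nv: "?h N *\<^sub>v v \<in> carrier_vec r" using N v(1) by simp
  have c0: "c \<noteq> 0"
  proof
    assume "c = 0"
    with vN have "v = 0 \<cdot>\<^sub>v (?h N *\<^sub>v v)" by simp
    also have "0 \<cdot>\<^sub>v w = 0\<^sub>v r" if "w \<in> carrier_vec r" for w :: "complex vec"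
      using that by (intro eq_vecI) auto
    note this[OF Nv]
    finally have "v = 0\<^sub>v r" .
    then show False using v by simp
  qed
  have "?h N *\<^sub>v v = inverse c \<cdot>\<^sub>v v"
    using vN c0 Nv by (metis left_inverse one_smult_vec smult_smult_assoc)
  then have "eigenvalue (?h N) (inverse c)"
    using v N by (auto simp: eigenvalue_def eigenvector_def)
  then have "inverse c \<in> \<int>"
    using int_mat_rational_eigenvalue[OF N] \<open>c \<in> \<rat>\<close> by simp
  moreover have "c \<in> \<int>"
    using int_mat_rational_eigenvalue[OF M _ \<open>c \<in> \<rat>\<close>] ev by (auto simp: eigenvalue_def)
  ultimately obtain a b where ab: "c = of_int a" "inverse c = of_int b" by (auto elim!: Ints_cases)
  then have "complex_of_int (a * b) = 1" using c0 by (metis of_int_mult right_inverse)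
  then have "a * b = 1" by (metis of_int_eq_1_iff)
  then show ?thesis using ab by (auto simp: zmult_eq_1_iff)
qed

lemma Ints_mat_obtain:
  fixes A :: "complex mat"
  assumes "A \<in> carrier_mat r r" "\<And>i j. i < r \<Longrightarrow> j < r \<Longrightarrow> A $$ (i, j) \<in> \<int>"
  obtains B where "B \<in> carrier_mat r r" "A = map_mat of_int B"
proof
  show "A = map_mat of_int (mat r r (\<lambda>ij. \<lfloor>Re (A $$ ij)\<rfloor>))"
    using assms by (intro eq_matI) (auto elim!: Ints_cases, metis Ints_cases Re_complex_of_real floor_of_int of_real_of_int_eq)
qed simp

section \<open>The matrix of RSK on a weight space\<close>

definition rsk_bitableau :: "nat \<Rightarrow> nat \<Rightarrow> expmat \<Rightarrow> zpoly" where
  "rsk_bitableau m n \<alpha> = (case RSK m n \<alpha> of (P, Q) \<Rightarrow> bitableau P Q)"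

definition rsk_lead :: "nat \<Rightarrow> nat \<Rightarrow> expmat \<Rightarrow> fvar \<Rightarrow>\<^sub>0 nat" where
  "rsk_lead m n \<alpha> = (case RSK m n \<alpha> of (P, Q) \<Rightarrow> tab_exp 0 P + tab_exp 1 Q)"

text \<open>The tags 0 and 1 keep the contributions of \<open>P\<close> and \<open>Q\<close> apart,
  so both tableaux can be read off, and they determine the exponent by injectivity of RSK.\<close>

lemma inj_on_rsk_lead: "inj_on (rsk_lead m n) (weight_exps m n \<sigma> \<pi>)"
proof (rule inj_onI)
  fix \<alpha> \<beta> assume a: "\<alpha> \<in> weight_exps m n \<sigma> \<pi>" and b: "\<beta> \<in> weight_exps m n \<sigma> \<pi>"
    and eq: "rsk_lead m n \<alpha> = rsk_lead m n \<beta>"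
  obtain P Q where PQ: "RSK m n \<alpha> = (P, Q)" by fastforce
  obtain P' Q' where PQ': "RSK m n \<beta> = (P', Q')" by fastforce
  have l: "Poly_Mapping.lookup (tab_exp 0 P) v + Poly_Mapping.lookup (tab_exp 1 Q) v =
      Poly_Mapping.lookup (tab_exp 0 P') v + Poly_Mapping.lookup (tab_exp 1 Q') v" for v
    using eq unfolding rsk_lead_def PQ PQ' by (metis case_prod_conv lookup_add)
  have "P = P'"
    using RSK_semistandard(1)[OF a PQ] RSK_semistandard(1)[OF b PQ'] l[of "(0, _, _)"]
    by (intro semistandard_eqI[of P P' 0]) (simp_all add: lookup_tab_exp)
  moreover have "Q = Q'"
    using RSK_semistandard(2)[OF a PQ] RSK_semistandard(2)[OF b PQ'] l[of "(1, _, _)"]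
    by (intro semistandard_eqI[of Q Q' 1]) (simp_all add: lookup_tab_exp)
  ultimately show "\<alpha> = \<beta>"
    using PQ PQ' inj_on_RSK weight_exps_exponent_matrices[OF a] weight_exps_exponent_matrices[OF b]
    by (metis inj_onD)
qed

lemma keys_rsk_bitableau:
  assumes "\<alpha> \<in> weight_exps m n \<sigma> \<pi>"
  shows "Poly_Mapping.keys (rsk_bitableau m n \<alpha>) \<subseteq> weight_exps m n \<sigma> \<pi>"
proof -
  obtain P Q where PQ: "RSK m n \<alpha> = (P, Q)" by fastforce
  show ?thesis
    using homogeneous_bitableau[of P Q] RSK_semistandard[OF assms PQ]
    by (auto simp: rsk_bitableau_def PQ homogeneous_def weight_exps_def)
qed

lemma weight_space_conv: "weight_space m n \<sigma> \<pi> = zpoly.span (monomial ` weight_exps m n \<sigma> \<pi>)"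
  unfolding weight_space_def weight_exps_eq ..

lemma keys_weight_space:
  assumes "f \<in> weight_space m n \<sigma> \<pi>"
  shows "Poly_Mapping.keys f \<subseteq> weight_exps m n \<sigma> \<pi>"
proof -
  let ?S = "weight_exps m n \<sigma> \<pi>"
  have "zpoly.subspace {f. Poly_Mapping.keys f \<subseteq> ?S}"
  proof (rule zpoly.subspaceI)
    show "x + y \<in> {f. Poly_Mapping.keys f \<subseteq> ?S}"
      if "x \<in> {f. Poly_Mapping.keys f \<subseteq> ?S}" "y \<in> {f. Poly_Mapping.keys f \<subseteq> ?S}" for x y :: zpoly
      using that Poly_Mapping.keys_add[of x y] by auto
    show "scale c x \<in> {f. Poly_Mapping.keys f \<subseteq> ?S}" if "x \<in> {f. Poly_Mapping.keys f \<subseteq> ?S}" for c x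
      using that by (auto simp: in_keys_iff)
  qed simp
  moreover have "monomial ` ?S \<subseteq> {f. Poly_Mapping.keys f \<subseteq> ?S}"
    by (auto simp: monomial_def)
  ultimately show ?thesis
    using assms zpoly.span_minimal unfolding weight_space_conv by blast
qed

theorem RSK_rational_eigenvalue:
  assumes "eigenvalue_on (weight_space m n \<sigma> \<pi>) (RSK_op m n) c" "c \<in> \<rat>"
  shows "c = 1 \<or> c = -1"
proof -
  let ?S = "weight_exps m n \<sigma> \<pi>"
  let ?lead = "rsk_lead m n"
  let ?bit = "rsk_bitableau m n"
  define r where "r = card ?S"
  \<comment> \<open>The leading exponents are listed increasingly, and \<open>\<alpha> i\<close> is
    the monomial whose bitableau has the \<open>i\<close>-th one. This order makes
    \<open>C * M\<close> triangular.\<close>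
  define \<mu> where "\<mu> i = sorted_list_of_set (?lead ` ?S) ! i" for i
  define \<alpha> where "\<alpha> i = inv_into ?S ?lead (\<mu> i)" for i
  have fin: "finite ?S" by (rule finite_weight_exps)
  have inj: "inj_on ?lead ?S" by (rule inj_on_rsk_lead)
  have len: "length (sorted_list_of_set (?lead ` ?S)) = r"
    by (simp add: r_def card_image[OF inj])
  have \<mu>_less: "\<mu> i < \<mu> j" if "i < j" "j < r" for i j
    using sorted_wrt_nth_less[OF strict_sorted_list_of_set, of i j "?lead ` ?S"] that len by (simp add: \<mu>_def)
  have \<mu>_bij: "bij_betw \<mu> {..<r} (?lead ` ?S)"
    using bij_betw_nth[of "sorted_list_of_set (?lead ` ?S)" "{..<r}" "?lead ` ?S"] fin len
    unfolding \<mu>_def[abs_def] by simp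
  have \<alpha>_bij: "bij_betw \<alpha> {..<r} ?S"
    using bij_betw_trans[OF \<mu>_bij bij_betw_inv_into[OF inj_on_imp_bij_betw[OF inj]]]
    by (simp add: \<alpha>_def[abs_def] comp_def)
  have \<alpha>_in: "\<alpha> i \<in> ?S" if "i < r" for i
    using \<alpha>_bij that by (auto simp: bij_betw_def)
  have lead_\<alpha>: "?lead (\<alpha> i) = \<mu> i" if "i < r" for i
    unfolding \<alpha>_def using \<mu>_bij that by (intro f_inv_into_f) (auto simp: bij_betw_def)
  \<comment> \<open>The largest number of rows that occurs; \<open>insert 0\<close> covers an empty
    weight set.\<close>
  define N where "N = Max (insert 0 ((\<lambda>\<alpha>. length (fst (RSK m n \<alpha>))) ` ?S))"
  have lead: "has_lead (factor_subst N (?bit \<beta>)) (?lead \<beta>)" if "\<beta> \<in> ?S" for \<beta>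
  proof -
    obtain P Q where PQ: "RSK m n \<beta> = (P, Q)" by fastforce
    have "length P \<le> N" unfolding N_def using fin that PQ by (intro Max_ge) force+
    then show ?thesis
      using has_lead_bitableau[of P Q N] RSK_semistandard[OF that PQ]
      by (simp add: rsk_bitableau_def rsk_lead_def PQ)
  qed
  \<comment> \<open>Column \<open>j\<close> of \<open>M\<close> expands the bitableau of
    \<open>\<alpha> j\<close> in monomials; \<open>C\<close> sends coordinates to the coefficients
    at the exponents \<open>\<mu> i\<close> after substitution.\<close>
  define M where "M = mat r r (\<lambda>(i, j). Poly_Mapping.lookup (?bit (\<alpha> j)) (\<alpha> i))"
  define C where "C = mat r r (\<lambda>(i, j). Poly_Mapping.lookup (factor_subst N (monomial (\<alpha> j))) (\<mu> i))"
  have M: "M \<in> carrier_mat r r" and C: "C \<in> carrier_mat r r" by (simp_all add: M_def C_def)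
  have CM: "(C * M) $$ (i, j) = Poly_Mapping.lookup (factor_subst N (?bit (\<alpha> j))) (\<mu> i)"
    if "i < r" "j < r" for i j
  proof -
    have "(C * M) $$ (i, j) = (\<Sum>k<r. Poly_Mapping.lookup (factor_subst N (monomial (\<alpha> k))) (\<mu> i) *
        Poly_Mapping.lookup (?bit (\<alpha> j)) (\<alpha> k))"
      using that by (simp add: M_def C_def scalar_prod_def lessThan_atLeast0)
    also have "\<dots> = (\<Sum>\<beta>\<in>?S. Poly_Mapping.lookup (factor_subst N (monomial \<beta>)) (\<mu> i) *
        Poly_Mapping.lookup (?bit (\<alpha> j)) \<beta>)"
      by (rule sum.reindex_bij_betw[OF \<alpha>_bij])
    also have "\<dots> = Poly_Mapping.lookup (factor_subst N (?bit (\<alpha> j))) (\<mu> i)"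
      by (rule factor_subst_expand[symmetric, OF fin keys_rsk_bitableau[OF \<alpha>_in[OF that(2)]]])
    finally show ?thesis .
  qed
  \<comment> \<open>For \<open>j < i\<close> the exponent \<open>\<mu> i\<close> lies above the
    leading exponent \<open>\<mu> j\<close> of column \<open>j\<close>; on the diagonal stands the
    leading coefficient.\<close>
  have "upper_triangular (C * M)"
  proof (rule upper_triangularI)
    fix i j assume "j < i" "i < dim_row (C * M)"
    then have ij: "j < i" "i < r" using C by simp_all
    have "\<mu> i \<notin> Poly_Mapping.keys (factor_subst N (?bit (\<alpha> j)))"
      using lead[OF \<alpha>_in[of j]] \<mu>_less[OF ij] ij lead_\<alpha>[of j] unfolding has_lead_def
      by (metis leD order.strict_trans)
    then show "(C * M) $$ (i, j) = 0" using CM[of i j] ij by (simp add: in_keys_iff)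
  qed
  moreover have "diag_mat (C * M) = replicate r 1"
    using CM lead[OF \<alpha>_in] lead_\<alpha> C M
    by (intro nth_equalityI) (auto simp: diag_mat_def has_lead_def simp del: index_mult_mat(1))
  ultimately have det: "det (C * M) = 1"
    using det_upper_triangular[of "C * M" r] C M by simp
  obtain M' where M': "M' \<in> carrier_mat r r" "M = map_mat of_int M'"
  proof (rule Ints_mat_obtain[OF M])
    have "integral_poly (?bit \<beta>)" for \<beta>
      by (simp add: rsk_bitableau_def integral_bitableau split: prod.split)
    then show "M $$ (i, j) \<in> \<int>" if "i < r" "j < r" for i j
      using that by (simp add: M_def integral_poly_def)
  qed
  obtain C' where C': "C' \<in> carrier_mat r r" "C = map_mat of_int C'"
  proof (rule Ints_mat_obtain[OF C])
    show "C $$ (i, j) \<in> \<int>" if "i < r" "j < r" for i j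
      using that integral_factor_subst_monomial by (simp add: C_def integral_poly_def)
  qed
  have "of_int (det (C' * M')) = (1::complex)"
    using det M' C' by (simp flip: of_int_hom.hom_det of_int_hom.mat_hom_mult[OF C'(1) M'(1)])
  then have det': "det (C' * M') = 1" by (metis of_int_eq_1_iff)
  obtain f where f: "f \<in> weight_space m n \<sigma> \<pi>" "f \<noteq> 0" "RSK_op m n f = scale c f"
    using assms(1) by (auto simp: eigenvalue_on_def)
  have kf: "Poly_Mapping.keys f \<subseteq> ?S" using f(1) by (rule keys_weight_space)
  \<comment> \<open>The coordinates of the eigenvector \<open>f\<close>; they determine it because
    its support lies in the weight set.\<close>
  define v where "v = vec r (\<lambda>i. Poly_Mapping.lookup f (\<alpha> i))"
  have "v \<noteq> 0\<^sub>v r"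
  proof
    assume v0: "v = 0\<^sub>v r"
    have "Poly_Mapping.lookup f (\<alpha> i) = 0" if "i < r" for i
      using v0 that unfolding v_def by (metis index_vec index_zero_vec(1))
    then have "\<forall>\<beta>\<in>?S. Poly_Mapping.lookup f \<beta> = 0"
      using \<alpha>_bij by (metis bij_betw_imp_surj_on imageE lessThan_iff)
    then have "f = 0"
      using kf by (intro poly_mapping_eqI) (metis in_keys_iff lookup_zero subsetD)
    then show False using f(2) by simp
  qed
  moreover have "M *\<^sub>v v = c \<cdot>\<^sub>v v"
  proof (rule eq_vecI)
    fix i assume "i < dim_vec (c \<cdot>\<^sub>v v)"
    then have i: "i < r" by (simp add: v_def)
    have "(M *\<^sub>v v) $ i = (\<Sum>j<r. Poly_Mapping.lookup (?bit (\<alpha> j)) (\<alpha> i) * Poly_Mapping.lookup f (\<alpha> j))"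
      using i by (simp add: M_def v_def scalar_prod_def lessThan_atLeast0)
    also have "\<dots> = (\<Sum>\<beta>\<in>?S. Poly_Mapping.lookup (?bit \<beta>) (\<alpha> i) * Poly_Mapping.lookup f \<beta>)"
      by (rule sum.reindex_bij_betw[OF \<alpha>_bij])
    also have "\<dots> = Poly_Mapping.lookup (RSK_op m n f) (\<alpha> i)"
      by (simp add: RSK_op_eq_sum[OF fin kf] lookup_sum rsk_bitableau_def mult.commute)
    finally show "(M *\<^sub>v v) $ i = (c \<cdot>\<^sub>v v) $ i" using f(3) i by (simp add: v_def)
  qed (simp add: M_def v_def)
  ultimately have "eigenvector (map_mat of_int M') v c"
    using M by (simp add: eigenvector_def flip: M'(2)) (simp add: v_def)
  then show ?thesis
    using unimodular_rational_eigenvalue[OF M'(1) C'(1) det'] assms(2) by blast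
qed

section \<open>The eigenvalue 1\<close>

lemma row_pass_sorted:
  "sorted (map fst w) \<Longrightarrow> row_pass w = (map fst w, map snd w, [])"
  by (induction w rule: rev_induct) (auto simp: sorted_append)

lemma bitableau_one_row:
  assumes "length p = length q"
  shows "bitableau [p] [q] = (\<Prod>c<length p. zvar (p ! c) (q ! c))"
  unfolding bitableau_def
  using assms by (auto intro!: prod.cong simp: column_Cons minor_def det_single)

lemma monomial_add: "monomial (\<alpha> + \<beta>) = monomial \<alpha> * monomial \<beta>"
  by (simp add: monomial_def mult_single)

lemma monomial_0: "monomial 0 = 1"
  by (simp add: monomial_def)

lemma monomial_sum: "monomial (sum f A) = (\<Prod>x\<in>A. monomial (f x))"
  by (induction A rule: infinite_finite_induct) (simp_all add: monomial_add monomial_0)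

text \<open>The northwest corner matrix with the given margins: its biletters form two weakly increasing
  words, so they are inserted into a single row.\<close>

lemma RSK_fixed_monomial:
  assumes "weight_pair m n d \<sigma> \<pi>"
  obtains \<alpha> where "\<alpha> \<in> weight_exps m n \<sigma> \<pi>" "RSK_op m n (monomial \<alpha>) = monomial \<alpha>"
proof -
  define p where "p = sorted_list_of_multiset (weight_mset m \<sigma>)"
  define q where "q = sorted_list_of_multiset (weight_mset n \<pi>)"
  \<comment> \<open>Both margins sum to \<open>d\<close>, so the two sorted index lists can be
    paired entry by entry.\<close>
  have len: "length p = length q"
    using assms unfolding p_def q_def weight_pair_def
    by (metis size_mset mset_sorted_list_of_multiset size_weight_mset)
  have srt: "sorted p" "sorted q" by (simp_all add: p_def q_def)
  define \<alpha> :: expmat where "\<alpha> = (\<Sum>c<length p. Poly_Mapping.single (p ! c, q ! c) 1)"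
  have e: "exp_mset \<alpha> = mset (zip p q)"
    using sum_mset_nth[of "\<lambda>x. {#x#}" "zip p q"] len by (simp add: \<alpha>_def exp_mset_sum)
  have "image_mset fst (exp_mset \<alpha>) = mset p" "image_mset snd (exp_mset \<alpha>) = mset q"
    unfolding e using len by (simp_all flip: mset_map)
  then have \<alpha>: "\<alpha> \<in> weight_exps m n \<sigma> \<pi>"
    by (simp add: weight_exps_def p_def q_def)
  have "sorted_wrt biletter_le (zip p q)"
    unfolding sorted_wrt_iff_nth_less
    using srt len by (auto simp: biletter_le_def sorted_iff_nth_mono le_less)
  \<comment> \<open>Both words are sorted in the reading order and have the same multiset of
    biletters.\<close>
  then have bl: "biletters m n \<alpha> = zip p q"
    using sorted_biletters mset_biletters[OF weight_exps_exponent_matrices[OF \<alpha>]] e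
    by (intro sorted_biletters_unique) auto
  have "RSK_op m n (monomial \<alpha>) = (\<Prod>c<length p. zvar (p ! c) (q ! c))"
  \<comment> \<open>In degree 0 the tableaux are empty and both sides equal 1.\<close>
  proof (cases "p = []")
    case True
    then show ?thesis by (simp add: RSK_op_monomial RSK_eq_RS bl bitableau_def)
  next
    case False
    then have "RSK m n \<alpha> = ([p], [q])"
      using RS_row_pass[OF \<open>sorted_wrt biletter_le (zip p q)\<close> _ row_pass_sorted] srt len
      by (simp add: RSK_eq_RS bl) (metis length_0_conv)
    then show ?thesis using len by (simp add: RSK_op_monomial bitableau_one_row)
  qed
  also have "\<dots> = monomial \<alpha>"
    by (simp add: \<alpha>_def monomial_sum zvar_def)
  finally show ?thesis using that \<alpha> by blast
qed

theorem proposition5p3: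
  fixes m n d :: nat and \<sigma> \<pi> :: "nat \<Rightarrow> nat"
  assumes "1 \<le> m" and "1 \<le> n"
    and "reduced_weight_pair m n d \<sigma> \<pi>"
  shows "(\<forall>c. eigenvalue_on (weight_space m n \<sigma> \<pi>) (RSK_op m n) c \<and> c \<in> \<rat> \<longrightarrow> c = 1 \<or> c = -1)
    \<and> eigenvalue_on (weight_space m n \<sigma> \<pi>) (RSK_op m n) 1"
proof
  show "\<forall>c. eigenvalue_on (weight_space m n \<sigma> \<pi>) (RSK_op m n) c \<and> c \<in> \<rat> \<longrightarrow> c = 1 \<or> c = -1"
    using RSK_rational_eigenvalue by blast
  obtain \<alpha> where \<alpha>: "\<alpha> \<in> weight_exps m n \<sigma> \<pi>" "RSK_op m n (monomial \<alpha>) = monomial \<alpha>"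
    using RSK_fixed_monomial assms(3) unfolding reduced_weight_pair_def by blast
  have "monomial \<alpha> \<in> weight_space m n \<sigma> \<pi>"
    unfolding weight_space_conv using \<alpha>(1) by (intro zpoly.span_base) blast
  moreover have "monomial \<alpha> \<noteq> 0"
    by (metis lookup_single_eq lookup_zero monomial_def zero_neq_one)
  ultimately show "eigenvalue_on (weight_space m n \<sigma> \<pi>) (RSK_op m n) 1"
    using \<alpha>(2) unfolding eigenvalue_on_def by (metis zpoly.scale_one)
qed

end
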